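(* Let $n=3$, let $(M,g,\phi)$ be the three-dimensional Horowitz-Myers geon with parameter $a_3>0$ and mass $m=-\frac{4\pi}{3}a_3$, and let $\Sigma\subset M$ be a graph over $T^2$. Suppose that the second fundamental form $\tilde h_{ab}$ of $\Sigma$ with respect to the conformal metric $\tilde g=\phi^2 g$ is non-negative definite and that $\min_\Sigma \phi>1$. Then $$Q(\Sigma)\le \frac{3m}{2},$$ where $Q(\Sigma)=6\int_\Omega \phi\,d\mathrm{vol}_g-\int_\Sigma \phi H\,d\mathrm{vol}_\gamma$. Moreover, equality holds if and only if $\Sigma$ is a coordinate torus $\{s\equiv \text{constant}\}$.
   Context: Three-dimensional Horowitz-Myers geon: fix $a_3>0$ and let $\phi(s)=\cosh^{2/3}(3s/2)$, which satisfies $\frac{d\phi}{ds}=\phi(1-\phi^{-3})^{1/2}$. $M$ has coordinates $s\in[0,\infty)$, $\xi\in\mathbb{R}/\frac{4\pi}{3}\mathbb{Z}$, $\theta\in\mathbb{R}/a_3\mathbb{Z}$ and metric $$g=ds^2+\Big(\frac{d\phi}{ds}\Big)^2d\xi^2+\phi^2 d\theta^2.$$ The $\xi$-circle collapses at $s=0$, and the period of $\xi$ is such that $g$ is smooth there, so $M$ is diffeomorphic to $\mathbb{R}^2\times S^1$. $\phi$ is regarded as a function on $M$ through $s$. A graph over $T^2=\mathbb{R}/\frac{4\pi}{3}\mathbb{Z}\times\mathbb{R}/a_3\mathbb{Z}$ is a hypersurface $\Sigma=\{s=v(\xi,\theta)\}$ with $v$ a smooth function on $T^2$. $\Omega$ is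 the bounded region enclosed by $\Sigma$, i.e. $\{s<v(\xi,\theta)\}$. $\gamma$ is the metric induced on $\Sigma$ by $g$, and $H$ is the mean curvature (trace of the second fundamental form) of $\Sigma$ in $(M,g)$ with respect to the outward unit normal $\nu$. The sign convention for the second fundamental form in any metric is $h(X,Y)=\langle\nabla_X\nu,Y\rangle$ with $\nu$ the outward unit normal of that metric; $\tilde h_{ab}$ is this form computed for $\tilde g=\phi^2g$. *)

theory Defs
  imports "HOL-Analysis.Analysis"
begin

section \<open>Local Riemannian geometry in coordinates\<close>

definition pd :: "'n::finite \<Rightarrow> (real^'n \<Rightarrow> real) \<Rightarrow> real^'n \<Rightarrow> real" where
  "pd i f x = deriv (\<lambda>t. f (x + t *\<^sub>R axis i 1)) 0"

primrec Ck :: "nat \<Rightarrow> (real^'n::finite \<Rightarrow> real) \<Rightarrow> bool" where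
  "Ck 0 f \<longleftrightarrow> continuous_on UNIV f"
| "Ck (Suc k) f \<longleftrightarrow> f differentiable_on UNIV \<and> (\<forall>i. Ck k (pd i f))"

definition smooth :: "(real^'n::finite \<Rightarrow> real) \<Rightarrow> bool" where
  "smooth f \<longleftrightarrow> (\<forall>k. Ck k f)"

text \<open>A metric is given by its component matrix at each point of a coordinate domain.\<close>

type_synonym 'n metric = "real^'n \<Rightarrow> real^'n^'n"

definition ip :: "'n::finite metric \<Rightarrow> real^'n \<Rightarrow> real^'n \<Rightarrow> real^'n \<Rightarrow> real" where
  "ip g x X Y = (\<Sum>i\<in>UNIV. \<Sum>j\<in>UNIV. g x $ i $ j * X $ i * Y $ j)"

text \<open>\<open>christoffel g x k i j\<close> is the Levi-Civita coefficient with upper index \<open>k\<close>.\<close>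

definition christoffel :: "'n::finite metric \<Rightarrow> real^'n \<Rightarrow> 'n \<Rightarrow> 'n \<Rightarrow> 'n \<Rightarrow> real" where
  "christoffel g x k i j =
     (1/2) * (\<Sum>l\<in>UNIV. matrix_inv (g x) $ k $ l *
        (pd i (\<lambda>y. g y $ j $ l) x + pd j (\<lambda>y. g y $ i $ l) x - pd l (\<lambda>y. g y $ i $ j) x))"

definition tangent :: "(real^'m::finite \<Rightarrow> real^'n::finite) \<Rightarrow> 'm \<Rightarrow> real^'m \<Rightarrow> real^'n" where
  "tangent F a p = (\<chi> i. pd a (\<lambda>q. F q $ i) p)"

text \<open>The covariant derivative, in the direction of the \<open>a\<close>-th coordinate tangent vector,
  of a vector field \<open>N\<close> of the ambient space along the immersion \<open>F\<close>.\<close>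

definition cov_along ::
  "'n::finite metric \<Rightarrow> (real^'m::finite \<Rightarrow> real^'n) \<Rightarrow> (real^'m \<Rightarrow> real^'n) \<Rightarrow> 'm \<Rightarrow> real^'m \<Rightarrow> real^'n"
where
  "cov_along g F N a p = (\<chi> k. pd a (\<lambda>q. N q $ k) p +
     (\<Sum>i\<in>UNIV. \<Sum>j\<in>UNIV. christoffel g (F p) k i j * tangent F a p $ i * N p $ j))"

definition induced_metric ::
  "'n::finite metric \<Rightarrow> (real^'m::finite \<Rightarrow> real^'n) \<Rightarrow> 'm metric"
where
  "induced_metric g F p = (\<chi> a b. ip g (F p) (tangent F a p) (tangent F b p))"


section \<open>The three-dimensional Horowitz-Myers geon\<close>

text \<open>Points are described by the coordinates \<open>(s, \<xi>, \<theta>)\<close>, with \<open>s = x $ 1 \<ge> 0\<close>, and with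
  \<open>\<xi> = x $ 2\<close>, \<open>\<theta> = x $ 3\<close> lifted from the circles of lengths \<open>4 * pi / 3\<close> and \<open>a3\<close> to the real
  line: subsets of the geon are represented by their periodic lifts. All curvature quantities are
  evaluated at \<open>s > 0\<close> only, where these coordinates are regular; the core \<open>s = 0\<close> is a null
  set for the volume integrals.\<close>

definition phi :: "real \<Rightarrow> real" where
  "phi s = cosh (3 * s / 2) powr (2/3)"

definition geon_metric :: "3 metric" where
  "geon_metric x = (\<chi> i j. if i = j
     then (vector [1, (deriv phi (x $ 1))^2, (phi (x $ 1))^2] :: real^3) $ i else 0)"

definition conf_metric :: "3 metric" where
  "conf_metric x = (phi (x $ 1))^2 *\<^sub>R geon_metric x"

definition geon_mass :: "real \<Rightarrow> real" where
  "geon_mass a3 = - (4 * pi / 3) * a3"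


section \<open>Graphs over the torus\<close>

definition torus_function :: "real \<Rightarrow> (real^2 \<Rightarrow> real) \<Rightarrow> bool" where
  "torus_function a3 v \<longleftrightarrow> smooth v \<and>
     (\<forall>p. v (p + axis 1 (4 * pi / 3)) = v p) \<and> (\<forall>p. v (p + axis 2 a3) = v p)"

text \<open>The condition \<open>0 \<le> v\<close> says that the graph lies in the geon.\<close>

definition graph_over_torus :: "real \<Rightarrow> (real^2 \<Rightarrow> real) \<Rightarrow> bool" where
  "graph_over_torus a3 v \<longleftrightarrow> torus_function a3 v \<and> (\<forall>p. 0 \<le> v p)"

definition graph_map :: "(real^2 \<Rightarrow> real) \<Rightarrow> real^2 \<Rightarrow> real^3" where
  "graph_map v p = vector [v p, p $ 1, p $ 2]"

definition graph_surface :: "(real^2 \<Rightarrow> real) \<Rightarrow> (real^3) set" where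
  "graph_surface v = range (graph_map v)"

definition enclosed_region :: "(real^2 \<Rightarrow> real) \<Rightarrow> (real^3) set" where
  "enclosed_region v = {x. 0 \<le> x $ 1 \<and> x $ 1 < v (vector [x $ 2, x $ 3])}"

definition coordinate_torus :: "real \<Rightarrow> (real^3) set" where
  "coordinate_torus c = {x. x $ 1 = c}"

text \<open>A vector \<open>n\<close> at a point of the graph is outward, i.e. points out of \<open>s < v\<close>, if the
  differential of \<open>s - v\<close> is positive on it.\<close>

definition outward :: "(real^2 \<Rightarrow> real) \<Rightarrow> real^2 \<Rightarrow> real^3 \<Rightarrow> bool" where
  "outward v p n \<longleftrightarrow> 0 < n $ 1 - pd 1 v p * n $ 2 - pd 2 v p * n $ 3"

definition unit_normal :: "3 metric \<Rightarrow> (real^2 \<Rightarrow> real) \<Rightarrow> real^2 \<Rightarrow> real^3" where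
  "unit_normal g v p = (THE n. (\<forall>a. ip g (graph_map v p) n (tangent (graph_map v) a p) = 0) \<and>
     ip g (graph_map v p) n n = 1 \<and> outward v p n)"

definition second_ff :: "3 metric \<Rightarrow> (real^2 \<Rightarrow> real) \<Rightarrow> real^2 \<Rightarrow> real^2^2" where
  "second_ff g v p = (\<chi> a b. ip g (graph_map v p)
     (cov_along g (graph_map v) (unit_normal g v) a p) (tangent (graph_map v) b p))"

definition mean_curvature :: "3 metric \<Rightarrow> (real^2 \<Rightarrow> real) \<Rightarrow> real^2 \<Rightarrow> real" where
  "mean_curvature g v p = (\<Sum>a\<in>UNIV. \<Sum>b\<in>UNIV.
     matrix_inv (induced_metric g (graph_map v) p) $ a $ b * second_ff g v p $ a $ b)"

definition nonneg_definite :: "real^'n^'n \<Rightarrow> bool" where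
  "nonneg_definite A \<longleftrightarrow> (\<forall>X. 0 \<le> X \<bullet> (A *v X))"


section \<open>The functional \<open>Q\<close>\<close>

text \<open>Integrals over the geon and over the graph are integrals over one period cell in \<open>\<xi>\<close> and
  \<open>\<theta>\<close>, against the Riemannian densities.\<close>

definition bulk_integral :: "3 metric \<Rightarrow> real \<Rightarrow> (real^2 \<Rightarrow> real) \<Rightarrow> (real^3 \<Rightarrow> real) \<Rightarrow> real" where
  "bulk_integral g a3 v f =
     (LINT z:{(s, \<xi>, \<theta>). vector [s, \<xi>, \<theta>] \<in> enclosed_region v \<and>
          \<xi> \<in> {0..<4 * pi / 3} \<and> \<theta> \<in> {0..<a3}}|lborel.
        (case z of (s, \<xi>, \<theta>) \<Rightarrow>
          f (vector [s, \<xi>, \<theta>]) * sqrt (det (g (vector [s, \<xi>, \<theta>])))))"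

definition surface_integral :: "3 metric \<Rightarrow> real \<Rightarrow> (real^2 \<Rightarrow> real) \<Rightarrow> (real^2 \<Rightarrow> real) \<Rightarrow> real" where
  "surface_integral g a3 v f =
     (LINT z:{0..<4 * pi / 3} \<times> {0..<a3}|lborel.
        (case z of (\<xi>, \<theta>) \<Rightarrow>
          f (vector [\<xi>, \<theta>]) * sqrt (det (induced_metric g (graph_map v) (vector [\<xi>, \<theta>])))))"

definition Q_functional :: "real \<Rightarrow> (real^2 \<Rightarrow> real) \<Rightarrow> real" where
  "Q_functional a3 v =
     6 * bulk_integral geon_metric a3 v (\<lambda>x. phi (x $ 1)) -
     surface_integral geon_metric a3 v (\<lambda>p. phi (v p) * mean_curvature geon_metric v p)"

end

(* Write y = |dv|^2 for the squared slope of the graph (grad_sq), A(y) = arctan(sqrt y)/sqrt y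
   (atan_ratio), K(y) = (1 - A(y))/y (atan_defect), and X = (phi^2/phi' v_xi, phi' v_theta). The
   integrand of the mean curvature term satisfies

     phi H dvol = 2 phi^3 - 1/2 + deficit - div (A(y) X),

   where A solves the ordinary differential equation 2 y A' + A = 1/(1+y), which is what cancels the
   second derivative of v in the gradient direction. In the deficit only the second derivative along
   the level curves of v is left, with the factor -K, and the convexity of the graph in phi^2 g bounds
   it by R, a positive definite quadratic form in dv; thus deficit >= R (1 - (1+y) K) =
   R ((1+y) A - 1)/y >= 0, which vanishes only where dv = 0. The divergence integrates to zero over
   the torus, and the bulk term is the integral of 2 (phi^3 - 1), so that Q = 3m/2 - (integral of
   the deficit). The choice of A comes from the unit speed normal flow in phi^2 g, along which Q
   increases to 3m/2. *)
theory Submission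
  imports Defs "HOL-Real_Asymp.Real_Asymp"
begin

section \<open>The warping function\<close>

text \<open>The derivative of \<open>phi\<close>, equal to phi (1 - phi^-3)^(1/2) for s >= 0. In
  this closed form it is odd and smooth through s = 0, so that two-sided derivatives exist at every
  s.\<close>

definition dphi :: "real \<Rightarrow> real" where
  "dphi s = phi s * tanh (3 * s / 2)"

definition ddphi :: "real \<Rightarrow> real" where
  "ddphi s = dphi s * tanh (3 * s / 2) + phi s * ((1 - (tanh (3 * s / 2))\<^sup>2) * (3/2))"

lemma phi_pos: "0 < phi s"
  by (simp add: phi_def)

lemma phi_has_derivative:
  "(phi has_real_derivative dphi s) (at s)"
proof -
  have "phi = (\<lambda>s. exp (2/3 * ln (cosh (3 * s / 2))))"
    by (auto simp: phi_def powr_def fun_eq_iff)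
  moreover have "((\<lambda>s. exp (2/3 * ln (cosh (3 * s / 2)))) has_real_derivative dphi s) (at s)"
    by (auto intro!: derivative_eq_intros simp: dphi_def phi_def powr_def tanh_def field_simps)
  ultimately show ?thesis by simp
qed

lemma dphi_has_derivative: "(dphi has_real_derivative ddphi s) (at s)"
proof -
  have "((\<lambda>s. phi s * tanh (3 * s / 2)) has_real_derivative ddphi s) (at s)"
    by (auto intro!: derivative_eq_intros DERIV_chain'[OF _ phi_has_derivative] phi_has_derivative
        simp: ddphi_def field_simps)
  then show ?thesis by (simp add: dphi_def[abs_def])
qed

lemma deriv_phi: "deriv phi = dphi"
  using DERIV_imp_deriv[OF phi_has_derivative] by auto

lemma phi_ge_1: "1 \<le> phi s"
  unfolding phi_def by (rule ge_one_powr_ge_zero) (auto simp: cosh_real_ge_1)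

lemma phi_0: "phi 0 = 1"
  by (simp add: phi_def)

lemma dphi_pos: "0 < s \<Longrightarrow> 0 < dphi s"
  by (simp add: dphi_def phi_pos)

lemma dphi_nonneg: "0 \<le> s \<Longrightarrow> 0 \<le> dphi s"
  by (simp add: dphi_def phi_pos less_imp_le)

text \<open>The first order equation phi'^2 = phi^2 - 1/phi of the warping function, cleared of its
  denominator; it comes from phi^3 = cosh^2 and tanh^2 = 1 - 1/cosh^2.\<close>

lemma dphi_squared: "phi s * (dphi s)\<^sup>2 = phi s ^ 3 - 1"
proof -
  have cube: "phi s ^ 3 = (cosh (3 * s / 2))\<^sup>2"
    by (simp add: phi_def powr_power)
  have "phi s ^ 3 * (tanh (3 * s / 2))\<^sup>2 = phi s ^ 3 - 1"
    unfolding cube by (simp add: tanh_def power_divide sinh_square_eq)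
  then show ?thesis
    by (simp add: dphi_def power2_eq_square power3_eq_cube algebra_simps)
qed

text \<open>The second order equation phi'' = phi + 1/(2 phi^2), again without denominators. With
  \<open>dphi_squared\<close> it reduces phi (phi'^2 + phi phi'') to 2 phi^3 - 1/2; by itself it
  yields positivity and continuity of \<open>ddphi\<close>.\<close>

lemma ddphi_eq: "2 * (phi s)\<^sup>2 * ddphi s = 2 * phi s ^ 3 + 1"
proof -
  have cube: "phi s ^ 3 = (cosh (3 * s / 2))\<^sup>2"
    by (simp add: phi_def powr_power)
  have t: "phi s ^ 3 * (tanh (3 * s / 2))\<^sup>2 = phi s ^ 3 - 1"
    unfolding cube by (simp add: tanh_def power_divide sinh_square_eq)
  have "2 * (phi s)\<^sup>2 * ddphi s = 3 * phi s ^ 3 - phi s ^ 3 * (tanh (3 * s / 2))\<^sup>2"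
    by (simp add: dphi_def ddphi_def power2_eq_square power3_eq_cube algebra_simps)
  with t show ?thesis by simp
qed

lemma ddphi_pos: "0 < ddphi s"
proof -
  have "0 < 2 * (phi s)\<^sup>2 * ddphi s"
    unfolding ddphi_eq using phi_pos[of s] by (simp add: add_pos_pos)
  then show ?thesis using phi_pos[of s] by (simp add: zero_less_mult_iff)
qed

lemma continuous_phi: "continuous_on S phi"
  by (meson DERIV_continuous_on phi_has_derivative has_field_derivative_at_within)

lemma continuous_dphi: "continuous_on S dphi"
  by (meson DERIV_continuous_on dphi_has_derivative has_field_derivative_at_within)

lemma continuous_ddphi: "continuous_on S ddphi"
proof -
  have eq: "ddphi = (\<lambda>s. (2 * phi s ^ 3 + 1) / (2 * (phi s)\<^sup>2))"
  proof
    fix s show "ddphi s = (2 * phi s ^ 3 + 1) / (2 * (phi s)\<^sup>2)"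
      using ddphi_eq[of s] phi_pos[of s] by (simp add: field_simps)
  qed
  have "phi s \<noteq> 0" for s
    using phi_pos[of s] by simp
  then show ?thesis
    unfolding eq by (intro continuous_intros continuous_phi) auto
qed

section \<open>The function \<open>arctan (sqrt y) / sqrt y\<close>\<close>

text \<open>The value \<open>1/3\<close> is the limit at \<open>0\<close>; extending it to negative arguments makes
  \<open>atan_ratio\<close> two-sided differentiable at \<open>0\<close>, where the gradient of the graph vanishes.\<close>

definition atan_defect :: "real \<Rightarrow> real" where
  "atan_defect y = (if y \<le> 0 then 1/3 else (1 - arctan (sqrt y) / sqrt y) / y)"

definition atan_ratio :: "real \<Rightarrow> real" where
  "atan_ratio y = 1 - y * atan_defect y"

text \<open>From the right this is the series arctan z / z = 1 - z^2/3 + ... at z = sqrt y; from the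
  left the function is constant.\<close>

lemma atan_defect_tendsto_0: "(atan_defect \<longlongrightarrow> 1/3) (at 0)"
proof -
  have "((\<lambda>y. (1 - arctan (sqrt y) / sqrt y) / y) \<longlongrightarrow> 1/3) (at_right 0)"
    by real_asymp
  then have "(atan_defect \<longlongrightarrow> 1/3) (at_right 0)"
    by (rule Lim_transform_eventually)
       (auto simp: atan_defect_def eventually_at_right_less intro!: eventually_mono[OF eventually_at_right_less])
  moreover have "(atan_defect \<longlongrightarrow> 1/3) (at_left 0)"
    by (rule Lim_transform_eventually[OF tendsto_const])
       (auto simp: atan_defect_def eventually_at_filter)
  ultimately show ?thesis by (simp add: filterlim_split_at)
qed

text \<open>The equation 2 y A' + A = 1/(1 + y) solved for A', with A = 1 - y K inserted: the factor
  y cancels, so that the formula covers y = 0 as well, with value -1/3.\<close>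

lemma atan_ratio_has_derivative:
  assumes "0 \<le> y"
  shows "(atan_ratio has_real_derivative (atan_defect y - 1 / (1 + y)) / 2) (at y)"
proof (cases "y = 0")
  case True
  \<comment> \<open>Since A(h) = 1 - h K(h), the difference quotient of A at 0 is exactly
    -K(h).\<close>
  have "((\<lambda>h. - atan_defect h) \<longlongrightarrow> - (1/3)) (at 0)"
    by (intro tendsto_intros atan_defect_tendsto_0)
  then have "((\<lambda>h. (atan_ratio (0 + h) - atan_ratio 0) / h) \<longlongrightarrow> - (1/3)) (at 0)"
    by (rule Lim_transform_eventually) (auto simp: atan_ratio_def eventually_at_filter)
  then show ?thesis
    using True by (simp add: DERIV_def atan_defect_def)
next
  case False
  with assms have y: "0 < y" by simp
  have "((\<lambda>y. arctan (sqrt y) / sqrt y) has_real_derivative (atan_defect y - 1 / (1 + y)) / 2) (at y)"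
  proof -
    define z where "z = sqrt y"
    have z: "0 < z" "y = z * z" "sqrt y = z" using y by (auto simp: z_def)
    have "((\<lambda>y. arctan (sqrt y) / sqrt y) has_real_derivative
       ((inverse (1 + z\<^sup>2) * (inverse z / 2)) * z - arctan z * (inverse z / 2)) / (z * z)) (at y)"
      using y z(1) by (auto intro!: derivative_eq_intros simp: z(3))
    moreover have "((inverse (1 + z\<^sup>2) * (inverse z / 2)) * z - arctan z * (inverse z / 2)) / (z * z)
        = (atan_defect y - 1 / (1 + y)) / 2"
    proof -
      define p where "p = 1 / (1 + z\<^sup>2)"
      have "1 + z\<^sup>2 \<noteq> 0" by (metis add_pos_nonneg less_irrefl zero_le_power2 zero_less_one)
      \<comment> \<open>Replacing p by 1 - p z^2 in the numerator splits off the summand -p after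
        division by z^2.\<close>
      then have p: "p = 1 - p * z\<^sup>2" by (simp add: p_def field_simps)
      have "((inverse (1 + z\<^sup>2) * (inverse z / 2)) * z - arctan z * (inverse z / 2)) / (z * z)
          = (p - arctan z / z) / z\<^sup>2 / 2"
        unfolding inverse_eq_divide p_def[symmetric]
        using z(1) by (simp add: power2_eq_square diff_divide_distrib mult.commute mult.left_commute)
      also have "(p - arctan z / z) / z\<^sup>2 = (1 - arctan z / z) / z\<^sup>2 - p"
        by (subst p) (use z(1) in \<open>simp add: diff_divide_distrib\<close>)
      also have "(1 - arctan z / z) / z\<^sup>2 = atan_defect y"
        using y by (simp add: atan_defect_def z_def)
      also have "p = 1 / (1 + y)"
        by (simp add: p_def z(2) power2_eq_square)
      finally show ?thesis .
    qed
    ultimately show ?thesis by (simp only:)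
  qed
  moreover have "\<forall>\<^sub>F x in nhds y. arctan (sqrt x) / sqrt x = atan_ratio x"
    using eventually_nhds_in_open[of "{0<..}" y] y
    by (auto simp: atan_ratio_def atan_defect_def elim!: eventually_mono)
  ultimately show ?thesis
    using DERIV_cong_ev[of y y "\<lambda>y. arctan (sqrt y) / sqrt y" atan_ratio] by simp
qed

lemma continuous_atan_defect: "continuous_on {0..} atan_defect"
proof -
  have "isCont atan_defect y" if "0 \<le> y" for y
  proof (cases "y = 0")
    case True
    then show ?thesis
      using atan_defect_tendsto_0 by (simp add: isCont_def atan_defect_def)
  next
    case False
    with that have "0 < y" by simp
    then have "isCont (\<lambda>y. (1 - arctan (sqrt y) / sqrt y) / y) y"
      by (intro continuous_intros) auto
    moreover have "\<forall>\<^sub>F x in nhds y. (1 - arctan (sqrt x) / sqrt x) / x = atan_defect x"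
      using eventually_nhds_in_open[of "{0<..}" y] \<open>0 < y\<close>
      by (auto simp: atan_defect_def elim!: eventually_mono)
    ultimately show ?thesis using isCont_cong by fast
  qed
  then show ?thesis by (simp add: continuous_at_imp_continuous_on)
qed

text \<open>With z = sqrt y the claim is equivalent to z < (1 + z^2) arctan z. The difference h of
  the two sides vanishes at 0 and has derivative 2 x arctan x > 0. The strictness decides the
  equality case later.\<close>

lemma atan_defect_bound:
  assumes "0 < y"
  shows "(1 + y) * atan_defect y < 1"
proof -
  define z where "z = sqrt y"
  have z: "0 < z" "y = z\<^sup>2" using assms by (auto simp: z_def)
  define h where "h = (\<lambda>x::real. (1 + x\<^sup>2) * arctan x - x)"
  have "h 0 < h z"
  proof (rule DERIV_pos_imp_increasing_open[OF z(1)])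
    fix x :: real assume x: "0 < x" "x < z"
    have "1 + x\<^sup>2 \<noteq> 0" by (metis add_pos_nonneg less_irrefl zero_le_power2 zero_less_one)
    then have "(h has_real_derivative 2 * x * arctan x) (at x)"
      unfolding h_def by (auto intro!: derivative_eq_intros simp: field_simps)
    moreover have "0 < 2 * x * arctan x" using x by simp
    ultimately show "\<exists>y. (h has_real_derivative y) (at x) \<and> 0 < y" by blast
  qed (auto simp: h_def intro!: continuous_intros)
  then have "z < (1 + z\<^sup>2) * arctan z" by (simp add: h_def)
  then have "1 < (1 + z\<^sup>2) * (arctan z / z)"
    using z(1) by (simp add: field_simps)
  then have "(1 + z\<^sup>2) * (1 - arctan z / z) < z\<^sup>2"
    by (simp add: algebra_simps)
  moreover have "(1 + y) * atan_defect y = (1 + z\<^sup>2) * (1 - arctan z / z) / z\<^sup>2"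
    using assms by (simp add: atan_defect_def z_def)
  ultimately show ?thesis
    using z(1) by simp
qed

lemma atan_defect_nonneg: "0 \<le> y \<Longrightarrow> 0 \<le> atan_defect y"
  by (auto simp: atan_defect_def divide_simps intro: arctan_le_self)

section \<open>Graphs in a diagonal metric\<close>

text \<open>The relational form of \<open>pd\<close>: it includes existence, and as a derivative in
  one real variable it is open to the usual derivative rules.\<close>

abbreviation has_pd :: "(real^'n::finite \<Rightarrow> real) \<Rightarrow> real \<Rightarrow> 'n \<Rightarrow> real^'n \<Rightarrow> bool" where
  "has_pd f d i x \<equiv> ((\<lambda>t. f (x + t *\<^sub>R axis i 1)) has_real_derivative d) (at 0)"

lemma pd_eq: "has_pd f d i x \<Longrightarrow> pd i f x = d"
  by (simp add: pd_def DERIV_imp_deriv)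

lemma has_pd_pd:
  assumes "f differentiable at x"
  shows "has_pd f (pd i f x) i x"
proof -
  have "(\<lambda>t. f (x + t *\<^sub>R axis i 1)) differentiable at 0"
    by (rule differentiable_chain_at[of "\<lambda>t. x + t *\<^sub>R axis i 1" 0 f, unfolded o_def])
       (use assms in auto)
  then show ?thesis
    by (simp add: pd_def DERIV_deriv_iff_real_differentiable)
qed

lemma has_pd_compose:
  assumes "(h has_real_derivative h') (at (f x))" and "has_pd f d i x"
  shows "has_pd (\<lambda>q. h (f q)) (h' * d) i x"
  using DERIV_chain2[of h h' "\<lambda>t. f (x + t *\<^sub>R axis i 1)" 0 d UNIV] assms by simp

lemma pd_const: "pd i (\<lambda>q. c) x = 0"
  by (simp add: pd_def)

lemma pd_coordinate: "pd i (\<lambda>q. q $ j) x = (if i = j then 1 else 0)"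
  by (rule pd_eq) (auto intro!: derivative_eq_intros simp: axis_def)

section \<open>Diagonal metrics depending on s only: inverse and Christoffel symbols\<close>

definition diag3 :: "real \<Rightarrow> real \<Rightarrow> real \<Rightarrow> real^3^3" where
  "diag3 a b c = (\<chi> i j. if i = j then (vector [a, b, c] :: real^3) $ i else 0)"

text \<open>Covers the geon metric and its conformal change alike, so that the second fundamental
  form is computed once for both.\<close>

definition diag_metric :: "(real \<Rightarrow> real) \<Rightarrow> (real \<Rightarrow> real) \<Rightarrow> (real \<Rightarrow> real) \<Rightarrow> 3 metric" where
  "diag_metric a b c x = diag3 (a (x $ 1)) (b (x $ 1)) (c (x $ 1))"

lemma diag3_nth [simp]:
  "diag3 a b c $ 1 $ 1 = a" "diag3 a b c $ 2 $ 2 = b" "diag3 a b c $ 3 $ 3 = c"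
  "i \<noteq> j \<Longrightarrow> diag3 a b c $ i $ j = 0"
  by (simp_all add: diag3_def)

lemma matrix_inv_unique:
  fixes A :: "real^'n^'n"
  assumes "A ** B = mat 1"
  shows "matrix_inv A = B"
proof -
  have BA: "B ** A = mat 1" using assms matrix_left_right_inverse by blast
  have "A ** matrix_inv A = mat 1 \<and> matrix_inv A ** A = mat 1"
    unfolding matrix_inv_def by (rule someI[of _ B]) (use assms BA in simp)
  then show ?thesis
    by (metis assms matrix_mul_assoc matrix_mul_lid matrix_mul_rid)
qed

lemma matrix_inv_diag3:
  assumes "a \<noteq> 0" "b \<noteq> 0" "c \<noteq> 0"
  shows "matrix_inv (diag3 a b c) = diag3 (1/a) (1/b) (1/c)"
  by (rule matrix_inv_unique)
     (use assms in \<open>simp add: vec_eq_iff matrix_matrix_mult_def forall_3 sum_3 mat_def\<close>)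

lemma ip_diag: "ip (diag_metric a b c) x X Y =
   a (x $ 1) * X $ 1 * Y $ 1 + b (x $ 1) * X $ 2 * Y $ 2 + c (x $ 1) * X $ 3 * Y $ 3"
  by (simp add: ip_def diag_metric_def sum_3)

lemma pd_diag_metric:
  assumes "(a has_real_derivative a') (at (x $ 1))"
    and "(b has_real_derivative b') (at (x $ 1))"
    and "(c has_real_derivative c') (at (x $ 1))"
  shows "pd i (\<lambda>y. diag_metric a b c y $ j $ k) x = (if i = 1 then diag3 a' b' c' $ j $ k else 0)"
proof -
  have first: "pd i (\<lambda>q. h (q $ 1)) x = (if i = 1 then h' else 0)"
    if "(h has_real_derivative h') (at (x $ 1))" for h :: "real \<Rightarrow> real" and h'
  proof -
    have "has_pd (\<lambda>q. q $ 1) (if i = 1 then 1 else 0) i x"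
      by (auto intro!: derivative_eq_intros simp: axis_def)
    from pd_eq[OF has_pd_compose[of h h', OF that this]] show ?thesis by simp
  qed
  show ?thesis
  proof (cases "j = k")
    case False
    then show ?thesis
      by (simp add: diag_metric_def pd_const)
  next
    case True
    consider "k = 1" | "k = 2" | "k = 3" using exhaust_3 by blast
    then show ?thesis
      unfolding True by cases (simp_all add: diag_metric_def first[OF assms(1)] first[OF assms(2)] first[OF assms(3)])
  qed
qed

text \<open>The inverse matrix is diagonal, which leaves l = k in the sum, and only derivatives in
  the first coordinate are non-zero.\<close>

lemma christoffel_diag:
  assumes "(a has_real_derivative a') (at (x $ 1))"
    and "(b has_real_derivative b') (at (x $ 1))"
    and "(c has_real_derivative c') (at (x $ 1))"
    and "a (x $ 1) \<noteq> 0" "b (x $ 1) \<noteq> 0" "c (x $ 1) \<noteq> 0"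
  shows "christoffel (diag_metric a b c) x k i j =
    1/2 * diag3 (1 / a (x $ 1)) (1 / b (x $ 1)) (1 / c (x $ 1)) $ k $ k *
      ((if i = 1 then diag3 a' b' c' $ j $ k else 0) + (if j = 1 then diag3 a' b' c' $ i $ k else 0)
        - (if k = 1 then diag3 a' b' c' $ i $ j else 0))"
proof -
  have inv: "matrix_inv (diag_metric a b c x) =
      diag3 (1 / a (x $ 1)) (1 / b (x $ 1)) (1 / c (x $ 1))"
    unfolding diag_metric_def by (rule matrix_inv_diag3) (use assms in auto)
  show ?thesis
    unfolding christoffel_def inv pd_diag_metric[OF assms(1-3)]
    using exhaust_3[of k] by (auto simp: sum_3)
qed

section \<open>Normal and second fundamental form of a graph\<close>

lemma tangent_graph_map:
  "tangent (graph_map v) 1 p = vector [pd 1 v p, 1, 0]"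
  "tangent (graph_map v) 2 p = vector [pd 2 v p, 0, 1]"
  by (simp_all add: tangent_def graph_map_def vec_eq_iff forall_3 pd_coordinate)

lemma graph_map_nth [simp]: "graph_map v p $ 1 = v p"
  by (simp add: graph_map_def)

text \<open>The squared norm of the conormal \<open>d (s - v)\<close>.\<close>

definition slant :: "3 metric \<Rightarrow> (real^2 \<Rightarrow> real) \<Rightarrow> real^2 \<Rightarrow> real" where
  "slant g v p = 1 / g (graph_map v p) $ 1 $ 1 + (pd 1 v p)\<^sup>2 / g (graph_map v p) $ 2 $ 2
     + (pd 2 v p)\<^sup>2 / g (graph_map v p) $ 3 $ 3"

lemma slant_diag: "slant (diag_metric a b c) v p =
    1 / a (v p) + (pd 1 v p)\<^sup>2 / b (v p) + (pd 2 v p)\<^sup>2 / c (v p)"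
  by (simp add: slant_def diag_metric_def)

lemma slant_diag_pos:
  assumes "0 < a (v p)" "0 < b (v p)" "0 < c (v p)"
  shows "0 < slant (diag_metric a b c) v p"
  unfolding slant_diag using assms by (intro add_pos_nonneg) auto

text \<open>The normal is the conormal d(s - v) with its index raised, divided by its length. For
  uniqueness, orthogonality to both tangent vectors makes n a multiple of the raised conormal; unit
  length and outwardness then fix the factor.\<close>

lemma unit_normal_diag:
  assumes "0 < a (v p)" "0 < b (v p)" "0 < c (v p)"
  shows "unit_normal (diag_metric a b c) v p = (1 / sqrt (slant (diag_metric a b c) v p)) *\<^sub>R
    vector [1 / a (v p), - pd 1 v p / b (v p), - pd 2 v p / c (v p)]"
    (is "_ = ?n")
proof -
  define w where "w = slant (diag_metric a b c) v p"
  have w0: "0 < w" unfolding w_def by (rule slant_diag_pos) (use assms in auto)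
  then have sq: "sqrt w * sqrt w = w" "sqrt w > 0" by auto
  define A B C where "A = a (v p)" and "B = b (v p)" and "C = c (v p)"
  note d = A_def[symmetric] B_def[symmetric] C_def[symmetric]
  define v1 v2 where "v1 = pd 1 v p" and "v2 = pd 2 v p"
  note dv = v1_def[symmetric] v2_def[symmetric]
  have pos: "0 < A" "0 < B" "0 < C" using assms by (auto simp: A_def B_def C_def)
  have w: "w = 1 / A + v1\<^sup>2 / B + v2\<^sup>2 / C"
    by (simp add: w_def slant_diag d dv)
  show ?thesis
    unfolding unit_normal_def w_def[symmetric]
  proof (rule the_equality)
    define n :: "real^3" where "n = (1 / sqrt w) *\<^sub>R vector [1 / A, - v1 / B, - v2 / C]"
    have n: "n $ 1 = 1 / (sqrt w * A)" "n $ 2 = - v1 / (sqrt w * B)" "n $ 3 = - v2 / (sqrt w * C)"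
      by (simp_all add: n_def)
    have "ip (diag_metric a b c) (graph_map v p) n (tangent (graph_map v) i p) = 0" for i
      using exhaust_2[of i] pos sq(2) by (auto simp: ip_diag tangent_graph_map n d dv)
    moreover have "ip (diag_metric a b c) (graph_map v p) n n = 1 / A / w + v1\<^sup>2 / B / w + v2\<^sup>2 / C / w"
      using pos w0
      by (simp add: ip_diag n d power2_eq_square mult.commute mult.left_commute)
    then have "ip (diag_metric a b c) (graph_map v p) n n = 1"
      using w0 unfolding add_divide_distrib[symmetric] w[symmetric] by simp
    moreover have "n $ 1 - v1 * n $ 2 - v2 * n $ 3 = 1 / A / sqrt w + v1\<^sup>2 / B / sqrt w + v2\<^sup>2 / C / sqrt w"
      unfolding n by (simp add: power2_eq_square mult.commute)
    then have "n $ 1 - v1 * n $ 2 - v2 * n $ 3 = w / sqrt w"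
      unfolding add_divide_distrib[symmetric] w[symmetric] .
    then have "outward v p n"
      using w0 by (simp add: outward_def dv)
    ultimately show "(\<forall>a'. ip (diag_metric a b c) (graph_map v p) ((1 / sqrt w) *\<^sub>R
        vector [1 / a (v p), - pd 1 v p / b (v p), - pd 2 v p / c (v p)]) (tangent (graph_map v) a' p) = 0) \<and>
     ip (diag_metric a b c) (graph_map v p) ((1 / sqrt w) *\<^sub>R
        vector [1 / a (v p), - pd 1 v p / b (v p), - pd 2 v p / c (v p)]) ((1 / sqrt w) *\<^sub>R
        vector [1 / a (v p), - pd 1 v p / b (v p), - pd 2 v p / c (v p)]) = 1 \<and>
     outward v p ((1 / sqrt w) *\<^sub>R
        vector [1 / a (v p), - pd 1 v p / b (v p), - pd 2 v p / c (v p)])"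
      unfolding d dv n_def[symmetric] by (intro conjI allI)
  next
    fix n :: "real^3"
    assume n: "(\<forall>a'. ip (diag_metric a b c) (graph_map v p) n (tangent (graph_map v) a' p) = 0) \<and>
      ip (diag_metric a b c) (graph_map v p) n n = 1 \<and> outward v p n"
    from n have t: "A * n $ 1 * v1 + B * n $ 2 = 0" "A * n $ 1 * v2 + C * n $ 3 = 0"
      and u: "A * n $ 1 * n $ 1 + B * n $ 2 * n $ 2 + C * n $ 3 * n $ 3 = 1"
      and o: "0 < n $ 1 - v1 * n $ 2 - v2 * n $ 3"
      by (auto simp: forall_2 ip_diag tangent_graph_map outward_def d dv)
    \<comment> \<open>The factor of proportionality, read off from the first component; it will
      satisfy \<mu>^2 w = 1 and \<mu> > 0.\<close>
    define \<mu> where "\<mu> = A * n $ 1"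
    have n1: "n $ 1 = \<mu> / A" using pos by (simp add: \<mu>_def)
    have "B * n $ 2 = - \<mu> * v1" "C * n $ 3 = - \<mu> * v2" using t by (auto simp: \<mu>_def)
    then have n2: "n $ 2 = - \<mu> * v1 / B" and n3: "n $ 3 = - \<mu> * v2 / C"
      using pos by (metis nonzero_mult_div_cancel_left less_irrefl)+
    have "n $ 1 - v1 * n $ 2 - v2 * n $ 3 = \<mu> * w"
      unfolding n1 n2 n3 w by (simp add: distrib_left power2_eq_square mult.commute mult.left_commute)
    with o w0 have mu: "0 < \<mu>" by (simp add: zero_less_mult_iff)
    have "A * n $ 1 * n $ 1 + B * n $ 2 * n $ 2 + C * n $ 3 * n $ 3 = \<mu>\<^sup>2 * w"
      unfolding n1 n2 n3 w using pos
      by (simp add: distrib_left power2_eq_square mult.commute mult.left_commute)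
    with u have "\<mu>\<^sup>2 * w = 1" by simp
    then have "sqrt (\<mu>\<^sup>2 * w) = 1" by simp
    then have "\<mu> * sqrt w = 1" using mu by (simp add: real_sqrt_mult)
    then have "\<mu> = 1 / sqrt w" using sq(2) by (simp add: field_simps)
    then show "n = (1 / sqrt w) *\<^sub>R vector [1 / a (v p), - pd 1 v p / b (v p), - pd 2 v p / c (v p)]"
      by (simp add: vec_eq_iff forall_3 n1 n2 n3 d dv)
  qed
qed

text \<open>The normal is written as W M with the normalising factor W and the raised conormal M.
  Positivity is asked at all points because the normal is differentiated, so its formula must hold
  around p. The orders of differentiation in the two off-diagonal entries are those in which the
  derivatives arise.\<close>

lemma second_ff_diag:
  assumes pos: "\<And>q. 0 < a (v q)" "\<And>q. 0 < b (v q)" "\<And>q. 0 < c (v q)"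
    and der: "(a has_real_derivative a') (at (v p))" "(b has_real_derivative b') (at (v p))"
      "(c has_real_derivative c') (at (v p))"
    and v: "v differentiable (at p)" and dv: "\<And>j. (pd j v) differentiable (at p)"
  defines "v1 \<equiv> pd 1 v p" and "v2 \<equiv> pd 2 v p"
    and "A \<equiv> a (v p)" and "B \<equiv> b (v p)" and "C \<equiv> c (v p)"
    and "w \<equiv> sqrt (slant (diag_metric a b c) v p)"
  shows "second_ff (diag_metric a b c) v p $ 1 $ 1 =
      (- pd 1 (pd 1 v) p - a' / (2 * A) * v1\<^sup>2 + b' / (2 * A) + v1\<^sup>2 * b' / B) / w" (is ?h11)
    and "second_ff (diag_metric a b c) v p $ 1 $ 2 =
      (- pd 1 (pd 2 v) p - a' / (2 * A) * v1 * v2 + v1 * v2 * b' / (2 * B) + v1 * v2 * c' / (2 * C)) / w" (is ?h12)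
    and "second_ff (diag_metric a b c) v p $ 2 $ 1 =
      (- pd 2 (pd 1 v) p - a' / (2 * A) * v1 * v2 + v1 * v2 * b' / (2 * B) + v1 * v2 * c' / (2 * C)) / w" (is ?h21)
    and "second_ff (diag_metric a b c) v p $ 2 $ 2 =
      (- pd 2 (pd 2 v) p - a' / (2 * A) * v2\<^sup>2 + c' / (2 * A) + v2\<^sup>2 * c' / C) / w" (is ?h22)
proof -
  let ?g = "diag_metric a b c"
  define W where "W = (\<lambda>q. 1 / sqrt (slant ?g v q))"
  define M :: "real^2 \<Rightarrow> real^3" where
    "M = (\<lambda>q. vector [1 / a (v q), - pd 1 v q / b (v q), - pd 2 v q / c (v q)])"
  have normal: "unit_normal ?g v = (\<lambda>q. W q *\<^sub>R M q)"
    by (rule ext) (unfold W_def M_def, rule unit_normal_diag; rule pos)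
  have ABC: "0 < A" "0 < B" "0 < C" using pos by (auto simp: A_def B_def C_def)
  have w0: "0 < w" unfolding w_def using slant_diag_pos[of a v p b c] pos by simp
  have W_p: "W p = 1 / w" by (simp add: W_def w_def)
  note nz = pos[THEN less_imp_neq, symmetric]
  have hv: "has_pd v (pd i v p) i p" "has_pd (pd j v) (pd i (pd j v) p) i p" for i j
    by (intro has_pd_pd v dv)+
  have hc: "has_pd (\<lambda>q. a (v q)) (a' * pd i v p) i p" "has_pd (\<lambda>q. b (v q)) (b' * pd i v p) i p"
    "has_pd (\<lambda>q. c (v q)) (c' * pd i v p) i p" for i
    by (intro has_pd_compose der hv)+
  define m1 m2 m3 where "m1 = (\<lambda>i. - a' * pd i v p / A\<^sup>2)"
    and "m2 = (\<lambda>i. - (pd i (pd 1 v) p * B - v1 * b' * pd i v p) / B\<^sup>2)"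
    and "m3 = (\<lambda>i. - (pd i (pd 2 v) p * C - v2 * c' * pd i v p) / C\<^sup>2)"
  have M_der: "has_pd (\<lambda>q. M q $ 1) (m1 i) i p" "has_pd (\<lambda>q. M q $ 2) (m2 i) i p"
    "has_pd (\<lambda>q. M q $ 3) (m3 i) i p" for i
    unfolding M_def m1_def m2_def m3_def vector_3
    by ((rule derivative_eq_intros hc hv refl | simp add: nz)+,
        simp add: A_def B_def C_def v1_def v2_def power2_eq_square)+
  \<comment> \<open>The derivative of W enters only multiplied by the inner product of M with a
    tangent vector, which is 0; its existence is enough.\<close>
  have "\<exists>d. has_pd W d i p" for i
  proof -
    have s0: "0 < slant ?g v p" using slant_diag_pos[of a v p b c] pos by simp
    have "\<exists>d. has_pd (\<lambda>q. slant ?g v q) d i p"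
      unfolding slant_diag by (rule exI) (rule derivative_eq_intros hc hv refl | simp add: nz)+
    then obtain d where d: "has_pd (slant ?g v) d i p" by blast
    have "((\<lambda>x. 1 / sqrt x) has_real_derivative - (inverse (sqrt (slant ?g v p)) / 2) / (sqrt (slant ?g v p))\<^sup>2)
      (at (slant ?g v p))"
      using s0 by (auto intro!: derivative_eq_intros simp: power2_eq_square)
    from has_pd_compose[of "\<lambda>x. 1 / sqrt x", OF this d] show ?thesis
      unfolding W_def by blast
  qed
  then obtain l where W_der: "\<And>i. has_pd W (l i) i p" by metis
  have N_der: "pd i (\<lambda>q. W q * M q $ k) p = l i * M p $ k + W p * m"
    if "has_pd (\<lambda>q. M q $ k) m i p" for i k m
  proof -
    have "has_pd (\<lambda>q. W q * M q $ k) (l i * M p $ k + W p * m) i p"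
      using DERIV_mult[OF W_der that] by (simp add: algebra_simps)
    then show ?thesis by (simp add: pd_eq)
  qed
  note chr = christoffel_diag[of a a' "graph_map v p" b b' c c', unfolded graph_map_nth, OF der nz,
      folded A_def B_def C_def]
  have M_p: "M p = vector [1 / A, - v1 / B, - v2 / C]"
    by (simp add: M_def A_def B_def C_def v1_def v2_def)
  show ?h11 ?h12 ?h21 ?h22
    unfolding second_ff_def cov_along_def normal
    using ABC w0
    by (simp_all add: ip_diag sum_3 chr N_der[OF M_der(1)] N_der[OF M_der(2)] N_der[OF M_der(3)]
          tangent_graph_map M_p W_p m1_def m2_def m3_def
          A_def[symmetric] B_def[symmetric] C_def[symmetric] v1_def[symmetric] v2_def[symmetric])
      (simp_all add: field_simps power2_eq_square)
qed

section \<open>The integrand of \<open>Q\<close>\<close>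

lemma geon_metric_diag: "geon_metric = diag_metric (\<lambda>_. 1) (\<lambda>s. (dphi s)\<^sup>2) (\<lambda>s. (phi s)\<^sup>2)"
  unfolding geon_metric_def[abs_def] diag_metric_def[abs_def] diag3_def deriv_phi ..

lemma conf_metric_diag:
  "conf_metric = diag_metric (\<lambda>s. (phi s)\<^sup>2) (\<lambda>s. (phi s * dphi s)\<^sup>2) (\<lambda>s. phi s ^ 4)"
  by (rule ext)
     (simp add: conf_metric_def geon_metric_diag diag_metric_def diag3_def vec_eq_iff forall_3 power_mult_distrib
        power2_eq_square power4_eq_xxxx)

lemma sqrt_det_geon_metric:
  assumes "0 \<le> x $ 1"
  shows "sqrt (det (geon_metric x)) = phi (x $ 1) * dphi (x $ 1)"
proof -
  have "det (geon_metric x) = (phi (x $ 1) * dphi (x $ 1))\<^sup>2"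
    by (simp add: geon_metric_diag diag_metric_def det_3 power_mult_distrib mult.commute)
  then show ?thesis
    using dphi_nonneg[OF assms] phi_pos[of "x $ 1"] by simp
qed

lemma matrix_inv_2:
  fixes A :: "real^2^2"
  assumes "det A \<noteq> 0"
  shows "matrix_inv A = (\<chi> i j. (if i = 1 then (if j = 1 then A $ 2 $ 2 else - A $ 1 $ 2)
     else (if j = 1 then - A $ 2 $ 1 else A $ 1 $ 1)) / det A)"
  by (rule matrix_inv_unique)
     (use assms in \<open>simp add: vec_eq_iff matrix_matrix_mult_def forall_2 sum_2 mat_def det_2
        mult.commute flip: diff_divide_distrib\<close>)

definition grad_sq :: "(real^2 \<Rightarrow> real) \<Rightarrow> real^2 \<Rightarrow> real" where
  "grad_sq v p = (pd 1 v p)\<^sup>2 / (dphi (v p))\<^sup>2 + (pd 2 v p)\<^sup>2 / (phi (v p))\<^sup>2"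

lemma grad_sq_nonneg: "0 \<le> grad_sq v p"
  by (simp add: grad_sq_def)

text \<open>The inverse of the induced metric is its cofactor matrix over the determinant (B f)^2 (1
  + y). The roots sqrt(1 + y) coming from the normal and from the area density combine, which leaves
  a rational expression.\<close>

lemma flux_density:
  assumes vpos: "\<And>q. 0 < v q"
    and v: "v differentiable (at p)" and dv: "\<And>j. (pd j v) differentiable (at p)"
  defines "v1 \<equiv> pd 1 v p" and "v2 \<equiv> pd 2 v p"
    and "f \<equiv> phi (v p)" and "B \<equiv> dphi (v p)" and "D \<equiv> ddphi (v p)"
  shows "phi (v p) * mean_curvature geon_metric v p *
      sqrt (det (induced_metric geon_metric (graph_map v) p)) =
    ((v2\<^sup>2 + f\<^sup>2) * (- pd 1 (pd 1 v) p + B * D + 2 * v1\<^sup>2 * D / B)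
     - v1 * v2 * (- pd 1 (pd 2 v) p - pd 2 (pd 1 v) p + 2 * v1 * v2 * (D / B + B / f))
     + (v1\<^sup>2 + B\<^sup>2) * (- pd 2 (pd 2 v) p + f * B + 2 * v2\<^sup>2 * B / f)) / (B * (1 + grad_sq v p))"
proof -
  have pos: "0 < f" "0 < B" using phi_pos dphi_pos vpos by (auto simp: f_def B_def)
  define U where "U = 1 + grad_sq v p"
  have U: "0 < U" using grad_sq_nonneg[of v p] by (simp add: U_def)
  have "((\<lambda>s. (dphi s)\<^sup>2) has_real_derivative 2 * B * D) (at (v p))"
    "((\<lambda>s. (phi s)\<^sup>2) has_real_derivative 2 * f * B) (at (v p))"
    by (auto intro!: derivative_eq_intros dphi_has_derivative phi_has_derivative simp: f_def B_def D_def)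
  note h = second_ff_diag[of "\<lambda>_. 1" v "\<lambda>s. (dphi s)\<^sup>2" "\<lambda>s. (phi s)\<^sup>2" 0 p,
      OF _ _ _ _ this v dv, folded geon_metric_diag, folded f_def B_def v1_def v2_def]
  have s: "slant geon_metric v p = U"
    by (simp add: geon_metric_diag slant_diag U_def grad_sq_def)
  define S11 S12 S21 S22 where "S11 = - pd 1 (pd 1 v) p + B * D + 2 * v1\<^sup>2 * D / B"
    and "S12 = - pd 1 (pd 2 v) p + v1 * v2 * (D / B + B / f)"
    and "S21 = - pd 2 (pd 1 v) p + v1 * v2 * (D / B + B / f)"
    and "S22 = - pd 2 (pd 2 v) p + f * B + 2 * v2\<^sup>2 * B / f"
  note S = this
  have hh: "second_ff geon_metric v p $ 1 $ 1 = S11 / sqrt U"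
    "second_ff geon_metric v p $ 1 $ 2 = S12 / sqrt U"
    "second_ff geon_metric v p $ 2 $ 1 = S21 / sqrt U"
    "second_ff geon_metric v p $ 2 $ 2 = S22 / sqrt U"
    using pos by (auto simp: S h s phi_pos dphi_pos vpos power2_eq_square algebra_simps)
  define G where "G = induced_metric geon_metric (graph_map v) p"
  have g: "G $ 1 $ 1 = v1\<^sup>2 + B\<^sup>2" "G $ 1 $ 2 = v1 * v2" "G $ 2 $ 1 = v1 * v2"
    "G $ 2 $ 2 = v2\<^sup>2 + f\<^sup>2"
    by (simp_all add: G_def induced_metric_def geon_metric_diag ip_diag tangent_graph_map v1_def v2_def
        f_def B_def power2_eq_square)
  have det: "det G = (B * f)\<^sup>2 * U"
    using pos by (simp add: det_2 g U_def grad_sq_def flip: v1_def v2_def f_def B_def)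
      (simp add: field_simps power2_eq_square)
  then have d0: "det G \<noteq> 0" using pos U by simp
  have sq: "sqrt (det G) = B * f * sqrt U"
    using pos by (simp add: det real_sqrt_mult)
  define N where "N = (v2\<^sup>2 + f\<^sup>2) * S11 - v1 * v2 * (S12 + S21) + (v1\<^sup>2 + B\<^sup>2) * S22"
  have "mean_curvature geon_metric v p = N / (det G * sqrt U)"
    unfolding mean_curvature_def G_def[symmetric] matrix_inv_2[OF d0]
    by (simp add: sum_2 hh g N_def add_divide_distrib diff_divide_distrib algebra_simps)
  then have "f * mean_curvature geon_metric v p * sqrt (det G) = N / (B * U)"
    unfolding sq using pos U by (simp add: det power2_eq_square)
  moreover have "S12 + S21 = - pd 1 (pd 2 v) p - pd 2 (pd 1 v) p + 2 * v1 * v2 * (D / B + B / f)"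
    by (simp add: S)
  ultimately show ?thesis
    by (simp add: N_def S11_def S22_def U_def G_def f_def)
qed

text \<open>Non-negativity of the conformal form on a single vector. Apart from second derivatives
  of v, only the terms b'/(2A) and c'/(2A) of \<open>second_ff_diag\<close> survive there, and they
  make up the right-hand side.\<close>

lemma convexity_bound:
  assumes vpos: "\<And>q. 0 < v q"
    and v: "v differentiable (at p)" and dv: "\<And>j. (pd j v) differentiable (at p)"
    and convex: "nonneg_definite (second_ff conf_metric v p)"
  defines "v1 \<equiv> pd 1 v p" and "v2 \<equiv> pd 2 v p"
    and "f \<equiv> phi (v p)" and "B \<equiv> dphi (v p)" and "D \<equiv> ddphi (v p)"
  shows "v2\<^sup>2 * pd 1 (pd 1 v) p - v1 * v2 * (pd 1 (pd 2 v) p + pd 2 (pd 1 v) p)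
      + v1\<^sup>2 * pd 2 (pd 2 v) p \<le> B * (2 * f * v1\<^sup>2 + v2\<^sup>2 * (B\<^sup>2 + f * D) / f)"
proof -
  have pos: "0 < f" "0 < B" using phi_pos dphi_pos vpos by (auto simp: f_def B_def)
  have "((\<lambda>s. (phi s)\<^sup>2) has_real_derivative 2 * f * B) (at (v p))"
    "((\<lambda>s. (phi s * dphi s)\<^sup>2) has_real_derivative 2 * f * B * (B\<^sup>2 + f * D)) (at (v p))"
    "((\<lambda>s. phi s ^ 4) has_real_derivative 4 * f ^ 3 * B) (at (v p))"
    by (auto intro!: derivative_eq_intros dphi_has_derivative phi_has_derivative
        simp: f_def B_def D_def power2_eq_square algebra_simps)
  note h = second_ff_diag[of "\<lambda>s. (phi s)\<^sup>2" v "\<lambda>s. (phi s * dphi s)\<^sup>2" "\<lambda>s. phi s ^ 4" _ p,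
      OF _ _ _ this v dv, folded conf_metric_diag, folded f_def B_def v1_def v2_def]
  define w where "w = sqrt (slant conf_metric v p)"
  have nn: "phi s \<noteq> 0" "dphi (v q) \<noteq> 0" for s q
    using phi_pos[of s] dphi_pos[OF vpos, of q] by auto
  have w: "0 < w" unfolding w_def conf_metric_diag
    using slant_diag_pos[of "\<lambda>s. (phi s)\<^sup>2" v p "\<lambda>s. (phi s * dphi s)\<^sup>2" "\<lambda>s. phi s ^ 4"]
    by (simp add: nn phi_pos)
  \<comment> \<open>tangent to the level curves of \<open>v\<close>, so every first order term containing \<open>dv(X)\<close> drops out\<close>
  define X :: "real^2" where "X = vector [v2, - v1]"
  let ?h = "second_ff conf_metric v p"
  have "X \<bullet> (?h *v X) =
      v2\<^sup>2 * ?h $ 1 $ 1 - v1 * v2 * (?h $ 1 $ 2 + ?h $ 2 $ 1) + v1\<^sup>2 * ?h $ 2 $ 2"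
    by (simp add: X_def inner_vec_def matrix_vector_mult_def sum_2 power2_eq_square algebra_simps)
  also have "\<dots> = (B * (2 * f * v1\<^sup>2 + v2\<^sup>2 * (B\<^sup>2 + f * D) / f) - (v2\<^sup>2 * pd 1 (pd 1 v) p
      - v1 * v2 * (pd 1 (pd 2 v) p + pd 2 (pd 1 v) p) + v1\<^sup>2 * pd 2 (pd 2 v) p)) / w"
    using pos w
    by (simp add: h nn phi_pos dphi_pos vpos w_def[symmetric])
       (simp add: field_simps power2_eq_square power3_eq_cube power4_eq_xxxx)
  finally show ?thesis
    using convex[unfolded nonneg_definite_def, rule_format, of X] w
    by (simp add: zero_le_divide_iff)
qed

text \<open>The letters stand for the values at one point: \<open>f = phi\<close>, \<open>B = phi'\<close>, \<open>D = phi''\<close>, \<open>vi\<close> and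
  \<open>vij\<close> the partial derivatives of \<open>v\<close>, \<open>yi\<close> those of \<open>y = grad_sq v\<close>. The bracket subtracted on the
  right is the divergence of the flux field when \<open>K = atan_defect y\<close>. The two mixed derivatives are
  kept apart because they occur only through their sum, so that their equality is not required.\<close>

lemma flux_identity:
  fixes v1 v2 f B D K y v11 v12 v21 v22 :: real
  assumes "0 < f" "0 < B"
  defines "y \<equiv> v1\<^sup>2 / B\<^sup>2 + v2\<^sup>2 / f\<^sup>2"
  defines "y1 \<equiv> 2 * v1 * v11 / B\<^sup>2 - 2 * v1\<^sup>2 * D * v1 / B ^ 3 + 2 * v2 * v12 / f\<^sup>2 - 2 * v2\<^sup>2 * B * v1 / f ^ 3"
    and "y2 \<equiv> 2 * v1 * v21 / B\<^sup>2 - 2 * v1\<^sup>2 * D * v2 / B ^ 3 + 2 * v2 * v22 / f\<^sup>2 - 2 * v2\<^sup>2 * B * v2 / f ^ 3"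
    and "R \<equiv> 2 * f * v1\<^sup>2 + v2\<^sup>2 * (B\<^sup>2 + f * D) / f"
    and "M \<equiv> v2\<^sup>2 * v11 - v1 * v2 * (v12 + v21) + v1\<^sup>2 * v22"
  shows "((v2\<^sup>2 + f\<^sup>2) * (- v11 + B * D + 2 * v1\<^sup>2 * D / B)
     - v1 * v2 * (- v12 - v21 + 2 * v1 * v2 * (D / B + B / f))
     + (v1\<^sup>2 + B\<^sup>2) * (- v22 + f * B + 2 * v2\<^sup>2 * B / f)) / (B * (1 + y)) =
    f * (B\<^sup>2 + f * D) + (1 - y * K) * R - K * M / B
    - ((K - 1 / (1 + y)) / 2 * (y1 * (f\<^sup>2 / B * v1) + y2 * (B * v2))
       + (1 - y * K) * (f\<^sup>2 / B * v11 + v1\<^sup>2 * (2 * f - f\<^sup>2 * D / B\<^sup>2) + B * v22 + D * v2\<^sup>2))"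
proof -
  \<comment> \<open>components in an orthonormal frame, in which only the denominator \<open>1 + y\<close> survives\<close>
  define P Q m11 m12 m21 m22 d where "P = v1 / B" and "Q = v2 / f" and "m11 = v11 / B\<^sup>2" and "m12 = v12 / (B * f)"
    and "m21 = v21 / (B * f)" and "m22 = v22 / f\<^sup>2" and "d = D / B"
  have e: "v1 = B * P" "v2 = f * Q" "v11 = B\<^sup>2 * m11" "v12 = B * f * m12" "v21 = B * f * m21" "v22 = f\<^sup>2 * m22"
    "D = B * d"
    using assms(1,2) by (auto simp: P_def Q_def m11_def m12_def m21_def m22_def d_def)
  \<comment> \<open>With d = D/B this turns D/B + B/f into d + r, and writing B as r f removes the
    remaining quotients.\<close>
  define r where "r = B / f"
  have Br: "B = r * f" and r: "0 < r" using assms(1,2) by (auto simp: r_def)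
  have y: "y = P\<^sup>2 + Q\<^sup>2" unfolding y_def e using assms(1,2) by (simp add: power_mult_distrib)
  define Z where "Z = 1 / (1 + y)"
  have "1 + y \<noteq> 0" unfolding y by (metis add_pos_nonneg less_irrefl sum_power2_ge_zero zero_less_one)
  then have Z: "Z * (1 + P\<^sup>2 + Q\<^sup>2) = 1" by (simp add: Z_def y add.assoc)
  have y1: "y1 = B * (2 * P * m11 - 2 * P ^ 3 * d + 2 * Q * m12 - 2 * Q\<^sup>2 * r * P)"
    unfolding y1_def e using assms(1,2) r unfolding Br
    by (simp add: field_simps power2_eq_square power3_eq_cube)
  have y2: "y2 = f * (2 * P * m21 - 2 * P\<^sup>2 * d * Q + 2 * Q * m22 - 2 * Q ^ 3 * r)"
    unfolding y2_def e using assms(1,2) r unfolding Br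
    by (simp add: field_simps power2_eq_square power3_eq_cube)
  have R: "R = B * f * (2 * P\<^sup>2 * B + Q\<^sup>2 * (B + f * d))"
    unfolding R_def e using assms(1,2) by (simp add: field_simps power2_eq_square)
  have M: "M / B = B * f\<^sup>2 * (Q\<^sup>2 * m11 - P * Q * (m12 + m21) + P\<^sup>2 * m22)"
    unfolding M_def e using assms(1,2) by (simp add: field_simps power2_eq_square)
  have lhs: "((v2\<^sup>2 + f\<^sup>2) * (- v11 + B * D + 2 * v1\<^sup>2 * D / B)
     - v1 * v2 * (- v12 - v21 + 2 * v1 * v2 * (D / B + B / f))
     + (v1\<^sup>2 + B\<^sup>2) * (- v22 + f * B + 2 * v2\<^sup>2 * B / f)) / (B * (1 + y))
     = B * f\<^sup>2 * Z * ((1 + Q\<^sup>2) * (- m11 + d + 2 * P\<^sup>2 * d) - P * Q * (- m12 - m21 + 2 * P * Q * (d + r))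
       + (1 + P\<^sup>2) * (- m22 + r + 2 * Q\<^sup>2 * r))"
  proof -
    have div: "X / (B * (1 + y)) = X / B * Z" for X by (simp add: Z_def)
    show ?thesis
      unfolding div unfolding e using assms(1,2) r unfolding Br
      by (simp add: field_simps power2_eq_square)
  qed
  have rhs: "f\<^sup>2 / B * v11 + v1\<^sup>2 * (2 * f - f\<^sup>2 * D / B\<^sup>2) + B * v22 + D * v2\<^sup>2 =
     B * f\<^sup>2 * (m11 + P\<^sup>2 * (2 * r - d) + m22 + d * Q\<^sup>2)"
    "f\<^sup>2 / B * v1 = f\<^sup>2 * P" "B * v2 = B * f * Q"
    unfolding e using assms(1,2) r unfolding Br by (simp_all add: field_simps power2_eq_square)
  have KM: "K * M / B = K * (B * f\<^sup>2 * (Q\<^sup>2 * m11 - P * Q * (m12 + m21) + P\<^sup>2 * m22))"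
    by (simp flip: M)
  \<comment> \<open>Both sides are now polynomials in f, r, d, K, Z and the frame components, equal
    modulo the relation Z (1 + P^2 + Q^2) = 1.\<close>
  show ?thesis
    unfolding lhs rhs y1 y2 R KM Z_def[symmetric]
    unfolding y e(7) Br using Z by algebra
qed

section \<open>Integration over a period cell\<close>

lemma smooth_differentiable: "smooth f \<Longrightarrow> f differentiable (at p)"
  unfolding smooth_def using Ck.simps(2)[of 0 f] by (auto simp: differentiable_on_def)

lemma smooth_pd:
  assumes "smooth f"
  shows "smooth (pd i f)"
  unfolding smooth_def
proof
  fix k show "Ck k (pd i f)" using assms Ck.simps(2)[of k f] unfolding smooth_def by blast
qed

lemma smooth_continuous: "smooth f \<Longrightarrow> continuous_on S f"
  unfolding smooth_def using Ck.simps(1)[of f] continuous_on_subset by blast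

abbreviation pt :: "real \<times> real \<Rightarrow> real^2" where
  "pt z \<equiv> vector [fst z, snd z]"

lemma vector2_eq: "(vector [x, y] :: real^2) = x *\<^sub>R axis 1 1 + y *\<^sub>R axis 2 1"
  by (simp add: vec_eq_iff forall_2 axis_def)

lemma vector2_add:
  "(vector [t + x, y] :: real^2) = vector [x, y] + t *\<^sub>R axis 1 1"
  "(vector [x, t + y] :: real^2) = vector [x, y] + t *\<^sub>R axis 2 1"
  by (simp_all add: vec_eq_iff forall_2 axis_def)

lemma pt_surj: "pt (p $ 1, p $ 2) = p"
  by (simp add: vec_eq_iff forall_2)

lemma continuous_on_pt: "continuous_on S pt"
  unfolding vector2_eq by (intro continuous_intros)

lemma has_pd_1_line:
  fixes F :: "real^2 \<Rightarrow> real"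
  assumes "\<And>p. has_pd F (G p) 1 p"
  shows "((\<lambda>x. F (vector [x, y])) has_real_derivative G (vector [x, y])) (at x)"
  using assms[of "vector [x, y]", folded vector2_add] DERIV_shift[of "\<lambda>x. F (vector [x, y])" "G (vector [x, y])" 0 x]
  by simp

lemma has_pd_2_line:
  fixes F :: "real^2 \<Rightarrow> real"
  assumes "\<And>p. has_pd F (G p) 2 p"
  shows "((\<lambda>y. F (vector [x, y])) has_real_derivative G (vector [x, y])) (at y)"
  using assms[of "vector [x, y]", folded vector2_add] DERIV_shift[of "\<lambda>y. F (vector [x, y])" "G (vector [x, y])" 0 y]
  by simp

lemma has_real_integral:
  fixes F :: "real \<Rightarrow> real"
  assumes "\<And>x. (F has_real_derivative f x) (at x)" "a \<le> b"
  shows "(f has_integral F b - F a) (cbox a b)"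
  unfolding cbox_interval
  by (rule fundamental_theorem_of_calculus)
     (use assms in \<open>auto simp: has_real_derivative_iff_has_vector_derivative[symmetric] intro: has_field_derivative_at_within\<close>)

text \<open>The divergence theorem on the torus, one direction at a time: along each line the
  integral is the change of F over a full period. The order of integration is swapped to bring
  direction 1 inside.\<close>

lemma integral_pd_periodic_1:
  assumes F: "\<And>p. has_pd F (G p) 1 p" and G: "continuous_on UNIV G"
    and per: "\<And>p. F (p + axis 1 S) = F p" and "0 < S" "0 < T"
  shows "integral (cbox (0, 0) (S, T)) (\<lambda>z. G (pt z)) = 0"
proof -
  have cont: "continuous_on (cbox (0, 0) (S, T)) (\<lambda>(x, y). G (vector [x, y]))"
    unfolding case_prod_unfold
    by (rule continuous_on_compose2[OF G continuous_on_pt]) auto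
  have "integral (cbox 0 S) (\<lambda>x. G (vector [x, y])) = 0" for y
  proof -
    have "axis 1 S = S *\<^sub>R (axis 1 1 :: real^2)" by (simp add: vec_eq_iff axis_def)
    then have "F (vector [S, y]) = F (vector [0, y])"
      using per[of "vector [0, y]"] vector2_add(1)[of S 0 y] by simp
    then show ?thesis
      using has_real_integral[OF has_pd_1_line[OF F], of 0 S y] \<open>0 < S\<close> by (simp add: integral_unique)
  qed
  then have "integral (cbox 0 T) (\<lambda>y. integral (cbox 0 S) (\<lambda>x. G (vector [x, y]))) = 0"
    by simp
  then have "integral (cbox 0 S) (\<lambda>x. integral (cbox 0 T) (\<lambda>y. G (vector [x, y]))) = 0"
    using integral_swap_continuous[OF cont] by simp
  then show ?thesis
    using integral_prod_continuous[OF cont] by (simp add: case_prod_unfold)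
qed

lemma integral_pd_periodic_2:
  assumes F: "\<And>p. has_pd F (G p) 2 p" and G: "continuous_on UNIV G"
    and per: "\<And>p. F (p + axis 2 T) = F p" and "0 < S" "0 < T"
  shows "integral (cbox (0, 0) (S, T)) (\<lambda>z. G (pt z)) = 0"
proof -
  have cont: "continuous_on (cbox (0, 0) (S, T)) (\<lambda>z. G (pt z))"
    by (rule continuous_on_compose2[OF G continuous_on_pt]) auto
  have "integral (cbox 0 T) (\<lambda>y. G (vector [x, y])) = 0" for x
  proof -
    have "axis 2 T = T *\<^sub>R (axis 2 1 :: real^2)" by (simp add: vec_eq_iff axis_def)
    then have "F (vector [x, T]) = F (vector [x, 0])"
      using per[of "vector [x, 0]"] vector2_add(2)[of x T 0] by simp
    then show ?thesis
      using has_real_integral[OF has_pd_2_line[OF F], of 0 T x] \<open>0 < T\<close> by (simp add: integral_unique)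
  qed
  then have "integral (cbox 0 S) (\<lambda>x. integral (cbox 0 T) (\<lambda>y. G (vector [x, y]))) = 0"
    by simp
  then show ?thesis
    using integral_prod_continuous[OF cont] by simp
qed

lemma set_integrable_half_open:
  fixes g :: "real \<times> real \<Rightarrow> real"
  assumes "continuous_on UNIV g"
  shows "set_integrable lborel ({0..<S} \<times> {0..<T}) g"
proof (rule set_integrable_subset)
  show "set_integrable lborel (cbox (0, 0) (S, T)) g"
    unfolding set_integrable_def
    by (rule borel_integrable_compact) (use assms continuous_on_subset in auto)
  show "{0..<S} \<times> {0..<T} \<in> sets lborel" by (simp add: borel_Times)
qed (auto simp: cbox_Pair_eq)

text \<open>The half-open cell of the definitions and the closed cell of the gauge integral differ
  by a part of the frontier, a null set.\<close>

lemma set_integral_half_open: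
  fixes g :: "real \<times> real \<Rightarrow> real"
  assumes "continuous_on UNIV g"
  shows "(LINT z:{0..<S} \<times> {0..<T}|lborel. g z) = integral (cbox (0, 0) (S, T)) g"
proof -
  let ?H = "{0..<S} \<times> {0..<T}"
  have sub: "box (0, 0) (S, T) \<subseteq> ?H" "?H \<subseteq> cbox (0, 0) (S, T)"
    by (auto simp: cbox_Pair_eq box_def Basis_prod_def)
  have "(LINT z:?H|lborel. g z) = integral ?H g"
    by (rule set_borel_integral_eq_integral(2)[OF set_integrable_half_open[OF assms]])
  also have "\<dots> = integral (cbox (0, 0) (S, T)) g"
    by (rule integral_spike_set)
       (use sub in \<open>auto intro: negligible_subset[OF negligible_frontier_interval[of "(0, 0)" "(S, T)"]]\<close>)
  finally show ?thesis .
qed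

section \<open>The flux field and its divergence\<close>

definition grad_sq_pd :: "(real^2 \<Rightarrow> real) \<Rightarrow> 2 \<Rightarrow> real^2 \<Rightarrow> real" where
  "grad_sq_pd v i p =
     2 * pd 1 v p * pd i (pd 1 v) p / (dphi (v p))\<^sup>2 - 2 * (pd 1 v p)\<^sup>2 * ddphi (v p) * pd i v p / dphi (v p) ^ 3
     + 2 * pd 2 v p * pd i (pd 2 v) p / (phi (v p))\<^sup>2 - 2 * (pd 2 v p)\<^sup>2 * dphi (v p) * pd i v p / phi (v p) ^ 3"

lemma grad_sq_has_pd:
  assumes "smooth v" "0 < v p"
  shows "has_pd (grad_sq v) (grad_sq_pd v i p) i p"
proof -
  have hv: "has_pd v (pd i v p) i p" "has_pd (pd j v) (pd i (pd j v) p) i p" for j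
    using assms(1) by (auto intro!: has_pd_pd smooth_differentiable smooth_pd)
  have hc: "has_pd (\<lambda>q. phi (v q)) (dphi (v p) * pd i v p) i p"
    "has_pd (\<lambda>q. dphi (v q)) (ddphi (v p) * pd i v p) i p"
    by (intro has_pd_compose phi_has_derivative dphi_has_derivative hv)+
  have pos: "phi (v p) > 0" "dphi (v p) > 0" using phi_pos dphi_pos assms(2) by auto
  show ?thesis
    unfolding grad_sq_def grad_sq_pd_def using pos
    by (auto intro!: derivative_eq_intros hc hv simp: field_simps power2_eq_square power3_eq_cube)
qed

text \<open>First component of A(y) X. Here X is the gradient of v in the metric of the slices s =
  const, multiplied by phi and by their area density phi phi'.\<close>

definition flux1 :: "(real^2 \<Rightarrow> real) \<Rightarrow> real^2 \<Rightarrow> real" where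
  "flux1 v p = atan_ratio (grad_sq v p) * ((phi (v p))\<^sup>2 / dphi (v p) * pd 1 v p)"

definition flux2 :: "(real^2 \<Rightarrow> real) \<Rightarrow> real^2 \<Rightarrow> real" where
  "flux2 v p = atan_ratio (grad_sq v p) * (dphi (v p) * pd 2 v p)"

text \<open>The factor (K - 1/(1 + y))/2 is A'(y); the terms are grouped as in the bracket of
  \<open>flux_identity\<close>.\<close>

definition flux1_pd :: "(real^2 \<Rightarrow> real) \<Rightarrow> real^2 \<Rightarrow> real" where
  "flux1_pd v p = (atan_defect (grad_sq v p) - 1 / (1 + grad_sq v p)) / 2 *
      (grad_sq_pd v 1 p * ((phi (v p))\<^sup>2 / dphi (v p) * pd 1 v p)) +
     atan_ratio (grad_sq v p) * ((phi (v p))\<^sup>2 / dphi (v p) * pd 1 (pd 1 v) p +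
       (pd 1 v p)\<^sup>2 * (2 * phi (v p) - (phi (v p))\<^sup>2 * ddphi (v p) / (dphi (v p))\<^sup>2))"

definition flux2_pd :: "(real^2 \<Rightarrow> real) \<Rightarrow> real^2 \<Rightarrow> real" where
  "flux2_pd v p = (atan_defect (grad_sq v p) - 1 / (1 + grad_sq v p)) / 2 *
      (grad_sq_pd v 2 p * (dphi (v p) * pd 2 v p)) +
     atan_ratio (grad_sq v p) * (dphi (v p) * pd 2 (pd 2 v) p + ddphi (v p) * (pd 2 v p)\<^sup>2)"

lemma flux_has_pd:
  assumes "smooth v" "0 < v p"
  shows "has_pd (flux1 v) (flux1_pd v p) 1 p" "has_pd (flux2 v) (flux2_pd v p) 2 p"
proof -
  have hv: "has_pd v (pd i v p) i p" "has_pd (pd j v) (pd i (pd j v) p) i p" for i j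
    using assms(1) by (auto intro!: has_pd_pd smooth_differentiable smooth_pd)
  have hc: "has_pd (\<lambda>q. phi (v q)) (dphi (v p) * pd i v p) i p"
    "has_pd (\<lambda>q. dphi (v q)) (ddphi (v p) * pd i v p) i p" for i
    by (intro has_pd_compose phi_has_derivative dphi_has_derivative hv)+
  have pos: "phi (v p) > 0" "dphi (v p) > 0" using phi_pos dphi_pos assms(2) by auto
  have ha: "has_pd (\<lambda>q. atan_ratio (grad_sq v q))
      ((atan_defect (grad_sq v p) - 1 / (1 + grad_sq v p)) / 2 * grad_sq_pd v i p) i p" for i
    by (intro has_pd_compose atan_ratio_has_derivative grad_sq_nonneg grad_sq_has_pd assms)
  have h1: "has_pd (\<lambda>q. (phi (v q))\<^sup>2 / dphi (v q) * pd 1 v q)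
    ((phi (v p))\<^sup>2 / dphi (v p) * pd 1 (pd 1 v) p +
       (pd 1 v p)\<^sup>2 * (2 * phi (v p) - (phi (v p))\<^sup>2 * ddphi (v p) / (dphi (v p))\<^sup>2)) 1 p"
    using pos by (auto intro!: derivative_eq_intros hc hv simp: field_simps power2_eq_square power3_eq_cube)
  have h2: "has_pd (\<lambda>q. dphi (v q) * pd 2 v q)
      (dphi (v p) * pd 2 (pd 2 v) p + ddphi (v p) * (pd 2 v p)\<^sup>2) 2 p"
    using pos by (auto intro!: derivative_eq_intros hc hv simp: power2_eq_square)
  show "has_pd (flux1 v) (flux1_pd v p) 1 p"
    unfolding flux1_def flux1_pd_def by (rule DERIV_cong[OF DERIV_mult[OF ha h1]]) (simp only: mult_ac scaleR_zero_left add_0_right)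
  show "has_pd (flux2 v) (flux2_pd v p) 2 p"
    unfolding flux2_def flux2_pd_def by (rule DERIV_cong[OF DERIV_mult[OF ha h2]]) (simp only: mult_ac scaleR_zero_left add_0_right)
qed

lemma pd_periodic:
  assumes "\<And>p. v (p + c) = v p"
  shows "pd i v (p + c) = pd i v p"
proof -
  have "v (p + c + t *\<^sub>R axis i 1) = v (p + t *\<^sub>R axis i 1)" for t
    using assms[of "p + t *\<^sub>R axis i 1"] by (simp add: algebra_simps)
  then show ?thesis by (simp add: pd_def)
qed

lemma flux_periodic:
  assumes "\<And>p. v (p + c) = v p"
  shows "flux1 v (p + c) = flux1 v p" "flux2 v (p + c) = flux2 v p"
  using assms pd_periodic[of v c, OF assms] by (simp_all add: flux1_def flux2_def grad_sq_def)

section \<open>The deficit and its sign\<close>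

definition deficit :: "(real^2 \<Rightarrow> real) \<Rightarrow> real^2 \<Rightarrow> real" where
  "deficit v p = atan_ratio (grad_sq v p) * (2 * phi (v p) * (pd 1 v p)\<^sup>2 +
       (pd 2 v p)\<^sup>2 * ((dphi (v p))\<^sup>2 + phi (v p) * ddphi (v p)) / phi (v p))
     - atan_defect (grad_sq v p) * ((pd 2 v p)\<^sup>2 * pd 1 (pd 1 v) p
        - pd 1 v p * pd 2 v p * (pd 1 (pd 2 v) p + pd 2 (pd 1 v) p)
        + (pd 1 v p)\<^sup>2 * pd 2 (pd 2 v) p) / dphi (v p)"

text \<open>\<open>flux_identity\<close> applied to \<open>flux_density\<close>: its leading term f
  (B^2 + f D) becomes 2 phi^3 - 1/2 by the two equations for phi, and A R - K M / B is the
  deficit.\<close>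

lemma flux_density_eq:
  assumes "smooth v" "\<And>q. 0 < v q"
  shows "phi (v p) * mean_curvature geon_metric v p *
      sqrt (det (induced_metric geon_metric (graph_map v) p)) =
    2 * phi (v p) ^ 3 - 1/2 + deficit v p - (flux1_pd v p + flux2_pd v p)"
proof -
  have pos: "0 < phi (v p)" "0 < dphi (v p)" using phi_pos dphi_pos assms(2) by auto
  have u: "phi (v p) * ((dphi (v p))\<^sup>2 + phi (v p) * ddphi (v p)) = 2 * phi (v p) ^ 3 - 1/2"
    using dphi_squared[of "v p"] ddphi_eq[of "v p"] by (simp add: power2_eq_square algebra_simps)
  note e = flux_identity[OF pos, where D = "ddphi (v p)" and K = "atan_defect (grad_sq v p)", unfolded u]
  note d = flux_density[of v p, OF assms(2) smooth_differentiable[OF assms(1)]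
      smooth_differentiable[OF smooth_pd[OF assms(1)]]]
  \<comment> \<open>Distributes the bracket of \<open>flux_identity\<close> over the two components
    of the divergence.\<close>
  have regroup: "E + A * R - N - (k * (X + Y) + A * (a + b + c + d)) =
      E + (A * R - N) - (k * X + A * (a + b) + (k * Y + A * (c + d)))"
    for E A R N k X Y a b c d :: real
    by (simp add: algebra_simps)
  show ?thesis
    unfolding d unfolding grad_sq_def unfolding e
    unfolding deficit_def flux1_pd_def flux2_pd_def grad_sq_pd_def atan_ratio_def grad_sq_def[symmetric]
    by (rule regroup)
qed

text \<open>As K is non-negative, the convexity bound M / phi' <= R gives the lower bound R (1 - (1
  + y) K), whose two factors are both positive wherever dv is non-zero.\<close>

lemma deficit_bound:
  assumes "smooth v" "\<And>q. 0 < v q" and "nonneg_definite (second_ff conf_metric v p)"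
  shows "0 \<le> deficit v p" and "deficit v p = 0 \<longleftrightarrow> pd 1 v p = 0 \<and> pd 2 v p = 0"
proof -
  define R where "R = 2 * phi (v p) * (pd 1 v p)\<^sup>2 +
       (pd 2 v p)\<^sup>2 * ((dphi (v p))\<^sup>2 + phi (v p) * ddphi (v p)) / phi (v p)"
  define M where "M = (pd 2 v p)\<^sup>2 * pd 1 (pd 1 v) p
        - pd 1 v p * pd 2 v p * (pd 1 (pd 2 v) p + pd 2 (pd 1 v) p) + (pd 1 v p)\<^sup>2 * pd 2 (pd 2 v) p"
  define y where "y = grad_sq v p"
  define K where "K = atan_defect y"
  have pos: "0 < phi (v p)" "0 < dphi (v p)" "0 < ddphi (v p)"
    using phi_pos dphi_pos ddphi_pos assms(2) by auto
  have y: "0 \<le> y" by (simp add: y_def grad_sq_nonneg)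
  have K: "0 \<le> K" using atan_defect_nonneg[OF y] by (simp add: K_def)
  have "M \<le> dphi (v p) * R"
    unfolding M_def R_def
    by (rule convexity_bound) (use assms in \<open>auto intro: smooth_differentiable smooth_pd\<close>)
  then have "M / dphi (v p) \<le> R" using pos by (simp add: divide_le_eq mult.commute)
  then have "K * (M / dphi (v p)) \<le> K * R" using K by (rule mult_left_mono)
  moreover have "deficit v p = (1 - y * K) * R - K * (M / dphi (v p))"
    by (simp add: deficit_def R_def M_def y_def K_def atan_ratio_def)
  ultimately have le: "R * (1 - (1 + y) * K) \<le> deficit v p"
    by (simp add: algebra_simps)
  have flat: "deficit v p = 0" if "pd 1 v p = 0 \<and> pd 2 v p = 0"
    using that by (simp add: deficit_def)
  have steep: "0 < deficit v p" if "\<not> (pd 1 v p = 0 \<and> pd 2 v p = 0)"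
  proof -
    have "0 < y" unfolding y_def grad_sq_def
    proof (cases "pd 1 v p = 0")
      case True
      with that pos show "0 < (pd 1 v p)\<^sup>2 / (dphi (v p))\<^sup>2 + (pd 2 v p)\<^sup>2 / (phi (v p))\<^sup>2" by simp
    next
      case False
      with pos show "0 < (pd 1 v p)\<^sup>2 / (dphi (v p))\<^sup>2 + (pd 2 v p)\<^sup>2 / (phi (v p))\<^sup>2"
        by (intro add_pos_nonneg) auto
    qed
    then have "0 < 1 - (1 + y) * K" using atan_defect_bound by (simp add: K_def)
    moreover have "0 < R"
    proof -
      have c: "0 < ((dphi (v p))\<^sup>2 + phi (v p) * ddphi (v p)) / phi (v p)"
        using pos by (intro divide_pos_pos add_pos_pos) auto
      have R: "R = 2 * phi (v p) * (pd 1 v p)\<^sup>2 +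
          (pd 2 v p)\<^sup>2 * (((dphi (v p))\<^sup>2 + phi (v p) * ddphi (v p)) / phi (v p))"
        by (simp add: R_def)
      show ?thesis
      proof (cases "pd 1 v p = 0")
        case True
        with that have "0 < (pd 2 v p)\<^sup>2" by simp
        from mult_pos_pos[OF this c] True show ?thesis unfolding R by simp
      next
        case False
        with pos c show ?thesis unfolding R by (intro add_pos_nonneg mult_nonneg_nonneg) auto
      qed
    qed
    ultimately show ?thesis using le by (meson less_le_trans mult_pos_pos)
  qed
  show "0 \<le> deficit v p" using flat steep by force
  show "deficit v p = 0 \<longleftrightarrow> pd 1 v p = 0 \<and> pd 2 v p = 0" using flat steep by force
qed

lemma continuous_flux_deficit:
  assumes "smooth v" "\<And>q. 0 < v q"
  shows "continuous_on UNIV (flux1_pd v)" "continuous_on UNIV (flux2_pd v)"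
    "continuous_on UNIV (deficit v)"
proof -
  have cv: "continuous_on UNIV v" "continuous_on UNIV (pd i v)" "continuous_on UNIV (pd i (pd j v))" for i j
    using assms(1) by (auto intro!: smooth_continuous smooth_pd)
  have cc: "continuous_on UNIV (\<lambda>p. phi (v p))" "continuous_on UNIV (\<lambda>p. dphi (v p))"
    "continuous_on UNIV (\<lambda>p. ddphi (v p))"
    using continuous_on_compose2[OF continuous_phi[of UNIV] cv(1)]
      continuous_on_compose2[OF continuous_dphi[of UNIV] cv(1)]
      continuous_on_compose2[OF continuous_ddphi[of UNIV] cv(1)] by auto
  have nz: "phi (v p) \<noteq> 0" "dphi (v p) \<noteq> 0" for p
    using phi_pos[of "v p"] dphi_pos[OF assms(2), of p] by auto
  have cy: "continuous_on UNIV (grad_sq v)"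
    unfolding grad_sq_def[abs_def] by (intro continuous_intros cv cc) (auto simp: nz)
  have cK: "continuous_on UNIV (\<lambda>p. atan_defect (grad_sq v p))"
    by (rule continuous_on_compose2[OF continuous_atan_defect cy]) (auto simp: grad_sq_nonneg)
  have y1: "1 + grad_sq v p \<noteq> 0" for p using grad_sq_nonneg[of v p] by simp
  have cdy: "continuous_on UNIV (grad_sq_pd v i)" for i
    unfolding grad_sq_pd_def[abs_def] by (intro continuous_intros cv cc) (auto simp: nz)
  show "continuous_on UNIV (flux1_pd v)" "continuous_on UNIV (flux2_pd v)"
    "continuous_on UNIV (deficit v)"
    unfolding flux1_pd_def[abs_def] flux2_pd_def[abs_def] deficit_def[abs_def] atan_ratio_def
    by (intro continuous_intros cv cc cy cK cdy; simp add: nz y1)+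
qed

section \<open>The inequality and its equality case\<close>

lemma set_integral_phi:
  assumes "0 \<le> c"
  shows "(LINT s:{0..<c}|lborel. phi s * (phi s * dphi s)) = (phi c ^ 3 - 1) / 3"
proof -
  have cont: "continuous_on X (\<lambda>s. phi s * (phi s * dphi s))" for X
    by (intro continuous_intros continuous_phi continuous_dphi)
  have "set_integrable lborel {0..<c} (\<lambda>s. phi s * (phi s * dphi s))"
  proof (rule set_integrable_subset)
    show "set_integrable lborel {0..c} (\<lambda>s. phi s * (phi s * dphi s))"
      unfolding set_integrable_def by (rule borel_integrable_compact) (auto intro: cont)
  qed auto
  then have "(LINT s:{0..<c}|lborel. phi s * (phi s * dphi s)) =
      integral {0..<c} (\<lambda>s. phi s * (phi s * dphi s))"
    by (rule set_borel_integral_eq_integral(2))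
  also have "\<dots> = integral (cbox 0 c) (\<lambda>s. phi s * (phi s * dphi s))"
    by (rule integral_spike_set)
       (auto intro: negligible_subset[of "{c}"] negligible_subset[of "{}"])
  also have "\<dots> = phi c ^ 3 / 3 - phi 0 ^ 3 / 3"
  proof (rule integral_unique[OF has_real_integral[OF _ assms]])
    show "((\<lambda>s. phi s ^ 3 / 3) has_real_derivative phi s * (phi s * dphi s)) (at s)" for s
      by (auto intro!: derivative_eq_intros phi_has_derivative simp: power2_eq_square)
  qed
  finally show ?thesis by (simp add: phi_0 diff_divide_distrib)
qed

text \<open>Fubini with the radial integral inside, where phi^3/3 is a primitive. Integrability
  holds because the region over one cell is a Borel subset of a compact box, v being bounded on the
  closed cell.\<close>

lemma bulk_integral_geon:
  assumes "smooth v" and v0: "\<And>p. 0 \<le> v p"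
  shows "bulk_integral geon_metric a3 v (\<lambda>x. phi (x $ 1)) =
    (LINT z:{0..<4 * pi / 3} \<times> {0..<a3}|lborel. (phi (v (pt z)) ^ 3 - 1) / 3)"
proof -
  let ?H = "{0..<4 * pi / 3} \<times> {0..<a3}"
  define E :: "(real \<times> real \<times> real) set"
    where "E = {w. 0 \<le> fst w \<and> fst w < v (pt (snd w)) \<and> snd w \<in> ?H}"
  define g :: "real \<times> real \<times> real \<Rightarrow> real"
    where "g = (\<lambda>w. phi (fst w) * (phi (fst w) * dphi (fst w)))"
  have region: "{(s, \<xi>, \<theta>). vector [s, \<xi>, \<theta>] \<in> enclosed_region v \<and>
      \<xi> \<in> {0..<4 * pi / 3} \<and> \<theta> \<in> {0..<a3}} = E"
    by (auto simp: E_def enclosed_region_def)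
  have cv: "continuous_on X (\<lambda>z. v (pt z))" for X
    by (rule continuous_on_compose2[OF smooth_continuous[OF assms(1), of UNIV] continuous_on_pt]) auto
  have cg: "continuous_on X g" for X
    unfolding g_def
    by (intro continuous_intros continuous_on_compose2[OF continuous_phi[of UNIV]]
        continuous_on_compose2[OF continuous_dphi[of UNIV]]) auto
  have E_sets: "E \<in> sets borel"
  proof -
    have "closed {w :: real \<times> real \<times> real. 0 \<le> fst w}"
      by (intro closed_Collect_le continuous_intros)
    moreover have "open {w :: real \<times> real \<times> real. fst w < v (pt (snd w))}"
      by (intro open_Collect_less continuous_on_compose2[OF cv[of UNIV]] continuous_intros) auto
    moreover have "(UNIV :: real set) \<times> ?H \<in> sets borel"
      by (intro borel_Times) auto
    moreover have "E = {w. 0 \<le> fst w} \<inter> {w. fst w < v (pt (snd w))} \<inter> UNIV \<times> ?H"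
      by (auto simp: E_def)
    ultimately show ?thesis by (auto intro!: sets.Int borel_closed borel_open)
  qed
  have E_int: "set_integrable lborel E g"
  proof -
    have "bounded ((\<lambda>z. v (pt z)) ` cbox (0, 0) (4 * pi / 3, a3))"
      by (intro compact_imp_bounded compact_continuous_image cv compact_cbox)
    then obtain b where "\<forall>x \<in> (\<lambda>z. v (pt z)) ` cbox (0, 0) (4 * pi / 3, a3). \<bar>x\<bar> \<le> b"
      unfolding bounded_real by blast
    then have b: "\<bar>v (pt z)\<bar> \<le> b" if "z \<in> cbox (0, 0) (4 * pi / 3, a3)" for z
      using that by blast
    have "E \<subseteq> cbox (0, 0, 0) (b, 4 * pi / 3, a3)"
    proof
      fix w assume w: "w \<in> E"
      then have "snd w \<in> cbox (0, 0) (4 * pi / 3, a3)" by (auto simp: E_def cbox_Pair_eq)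
      with w b[of "snd w"] show "w \<in> cbox (0, 0, 0) (b, 4 * pi / 3, a3)"
        by (cases w) (auto simp: E_def cbox_Pair_eq)
    qed
    moreover have "set_integrable lborel (cbox (0, 0, 0) (b, 4 * pi / 3, a3)) g"
      unfolding set_integrable_def by (rule borel_integrable_compact) (auto intro: cg)
    ultimately show ?thesis using E_sets by (auto intro: set_integrable_subset)
  qed
  \<comment> \<open>On E the coordinate s is non-negative, so that the root of the determinant is
    phi phi' with the right sign.\<close>
  have "bulk_integral geon_metric a3 v (\<lambda>x. phi (x $ 1)) = (LINT w:E|lborel. g w)"
    unfolding bulk_integral_def region
    by (rule set_lebesgue_integral_cong)
       (use E_sets in \<open>auto simp: E_def g_def sqrt_det_geon_metric\<close>)
  also have "\<dots> = integral\<^sup>L (lborel \<Otimes>\<^sub>M lborel) (\<lambda>(s, z). indicator E (s, z) *\<^sub>R g (s, z))"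
    by (simp add: set_lebesgue_integral_def lborel_prod case_prod_unfold)
  also have "\<dots> = (\<integral>z. \<integral>s. indicator E (s, z) *\<^sub>R g (s, z) \<partial>lborel \<partial>lborel)"
    by (rule lborel_pair.integral_snd[symmetric])
       (use E_int in \<open>simp add: set_integrable_def lborel_prod case_prod_unfold\<close>)
  also have "\<dots> = (LINT z:?H|lborel. (phi (v (pt z)) ^ 3 - 1) / 3)"
  proof -
    have "(\<integral>s. indicator E (s, z) *\<^sub>R g (s, z) \<partial>lborel) =
        indicator ?H z *\<^sub>R ((phi (v (pt z)) ^ 3 - 1) / 3)" for z
    proof -
      have "(\<integral>s. indicator E (s, z) *\<^sub>R g (s, z) \<partial>lborel) =
          (\<integral>s. indicator ?H z * (indicator {0..<v (pt z)} s *\<^sub>R (phi s * (phi s * dphi s))) \<partial>lborel)"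
        by (rule Bochner_Integration.integral_cong) (auto simp: E_def g_def indicator_def)
      also have "\<dots> = indicator ?H z * (LINT s:{0..<v (pt z)}|lborel. phi s * (phi s * dphi s))"
        by (simp add: set_lebesgue_integral_def)
      finally show ?thesis by (simp add: set_integral_phi[OF v0])
    qed
    then show ?thesis unfolding set_lebesgue_integral_def by (simp only:)
  qed
  finally show ?thesis .
qed

text \<open>The cubic terms cancel: 2 (phi^3 - 1) - (2 phi^3 - 1/2) = -3/2, and -3/2 times the
  coordinate area (4 pi / 3) a3 of the cell is 3m/2. The divergence integrates to 0 by
  periodicity.\<close>

lemma Q_functional_eq:
  assumes "0 < a3" and tf: "torus_function a3 v" and vpos: "\<And>p. 0 < v p"
  shows "Q_functional a3 v =
    3 * geon_mass a3 / 2 - integral (cbox (0, 0) (4 * pi / 3, a3)) (\<lambda>z. deficit v (pt z))"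
proof -
  let ?H = "{0..<4 * pi / 3} \<times> {0..<a3}" and ?C = "cbox (0, 0) (4 * pi / 3, a3)"
  have v: "smooth v" and per: "\<And>p. v (p + axis 1 (4 * pi / 3)) = v p" "\<And>p. v (p + axis 2 a3) = v p"
    using tf by (auto simp: torus_function_def)
  note cont = continuous_flux_deficit[OF v vpos]
  have pt: "continuous_on X (\<lambda>z. F (pt z))" if "continuous_on UNIV F" for F :: "real^2 \<Rightarrow> real" and X
    by (rule continuous_on_compose2[OF that continuous_on_pt]) auto
  have cphi: "continuous_on UNIV (\<lambda>p. phi (v p))"
    by (rule continuous_on_compose2[OF continuous_phi[of UNIV] smooth_continuous[OF v]]) auto
  define L where "L = (\<lambda>p. 2 * phi (v p) ^ 3 - 1/2 + deficit v p - (flux1_pd v p + flux2_pd v p))"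
  have cL: "continuous_on UNIV L"
    unfolding L_def by (intro continuous_intros cphi cont)
  have "surface_integral geon_metric a3 v (\<lambda>p. phi (v p) * mean_curvature geon_metric v p) =
      (LINT z:?H|lborel. L (pt z))"
    unfolding surface_integral_def L_def flux_density_eq[OF v vpos] case_prod_unfold ..
  also have "\<dots> = integral ?C (\<lambda>z. L (pt z))"
    by (rule set_integral_half_open[OF pt[OF cL]])
  finally have surface: "surface_integral geon_metric a3 v (\<lambda>p. phi (v p) * mean_curvature geon_metric v p) =
      integral ?C (\<lambda>z. L (pt z))" .
  have "bulk_integral geon_metric a3 v (\<lambda>x. phi (x $ 1)) = integral ?C (\<lambda>z. (phi (v (pt z)) ^ 3 - 1) / 3)"
    unfolding bulk_integral_geon[OF v vpos[THEN less_imp_le]]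
    by (rule set_integral_half_open) (intro continuous_intros pt[OF cphi], simp)
  then have "Q_functional a3 v =
      integral ?C (\<lambda>z. 6 * ((phi (v (pt z)) ^ 3 - 1) / 3)) - integral ?C (\<lambda>z. L (pt z))"
    unfolding Q_functional_def surface by (simp only: Henstock_Kurzweil_Integration.integral_mult_right)
  also have "\<dots> = integral ?C (\<lambda>z. 6 * ((phi (v (pt z)) ^ 3 - 1) / 3) - L (pt z))"
    by (intro Henstock_Kurzweil_Integration.integral_diff[symmetric] integrable_continuous
        continuous_intros pt cphi cL) simp
  also have "(\<lambda>z. 6 * ((phi (v (pt z)) ^ 3 - 1) / 3) - L (pt z)) =
      (\<lambda>z. (- (3/2) - deficit v (pt z)) + (flux1_pd v (pt z) + flux2_pd v (pt z)))"
    by (simp add: L_def fun_eq_iff diff_divide_distrib)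
  also have "integral ?C \<dots> = integral ?C (\<lambda>z. - (3/2) - deficit v (pt z)) +
      (integral ?C (\<lambda>z. flux1_pd v (pt z)) + integral ?C (\<lambda>z. flux2_pd v (pt z)))"
    by (simp add: Henstock_Kurzweil_Integration.integral_add integrable_continuous continuous_intros pt cont)
  also have "integral ?C (\<lambda>z. flux1_pd v (pt z)) = 0"
    by (rule integral_pd_periodic_1[of "flux1 v"])
       (use \<open>0 < a3\<close> in \<open>auto intro: flux_has_pd v vpos cont flux_periodic per\<close>)
  also have "integral ?C (\<lambda>z. flux2_pd v (pt z)) = 0"
    by (rule integral_pd_periodic_2[of "flux2 v"])
       (use \<open>0 < a3\<close> in \<open>auto intro: flux_has_pd v vpos cont flux_periodic per\<close>)
  also have "integral ?C (\<lambda>z. - (3/2) - deficit v (pt z)) =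
      integral ?C (\<lambda>z. - (3/2)) - integral ?C (\<lambda>z. deficit v (pt z))"
    by (intro Henstock_Kurzweil_Integration.integral_diff integrable_continuous continuous_intros pt cont)
  also have "integral ?C (\<lambda>z. - (3/2)) = 3 * geon_mass a3 / 2"
    using \<open>0 < a3\<close> by (simp add: content_Pair geon_mass_def)
  finally show ?thesis by simp
qed

section \<open>The equality case: from a flat cell to a coordinate torus\<close>

lemma periodic_reduce:
  fixes f :: "real \<Rightarrow> 'a"
  assumes per: "\<And>x. f (x + T) = f x" and "0 < T"
  obtains t where "0 \<le> t" "t \<le> T" "f x = f t"
proof -
  have nat: "f (x + real n * T) = f x" for n x
  proof (induction n)
    case (Suc n)
    have "f (x + real (Suc n) * T) = f ((x + real n * T) + T)" by (simp add: algebra_simps)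
    then show ?case using per Suc by simp
  qed simp
  define k where "k = \<lfloor>x / T\<rfloor>"
  define t where "t = x - of_int k * T"
  have "of_int k \<le> x / T" "x / T < of_int k + 1" by (simp_all add: k_def)
  then have "0 \<le> t" "t \<le> T" using \<open>0 < T\<close> by (auto simp: t_def field_simps)
  moreover have "f x = f t"
  \<comment> \<open>Natural multiples of T are added to t in order to reach x, or to x in order to
    reach t, according to the sign of k.\<close>
  proof (cases "0 \<le> k")
    case True
    then show ?thesis using nat[of t "nat k"] by (simp add: t_def)
  next
    case False
    then show ?thesis using nat[of x "nat (- k)"] by (simp add: t_def)
  qed
  ultimately show ?thesis by (rule that)
qed

text \<open>Inside the cell, v is followed first in direction 1 to the edge x = 0 and then along
  that edge to the origin; periodicity carries the value to all other points.\<close>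

lemma constant_if_flat_on_cell:
  assumes tf: "torus_function a3 v" and "0 < a3"
    and flat: "\<And>z. z \<in> cbox (0, 0) (4 * pi / 3, a3) \<Longrightarrow> pd 1 v (pt z) = 0 \<and> pd 2 v (pt z) = 0"
  shows "v p = v 0"
proof -
  have v: "smooth v" and per: "\<And>p. v (p + axis 1 (4 * pi / 3)) = v p" "\<And>p. v (p + axis 2 a3) = v p"
    using tf by (auto simp: torus_function_def)
  have cell: "v (vector [x, y]) = v 0" if xy: "0 \<le> x" "x \<le> 4 * pi / 3" "0 \<le> y" "y \<le> a3" for x y
  proof -
    have in_cell: "pd 1 v (vector [s, t]) = 0 \<and> pd 2 v (vector [s, t]) = 0"
      if "0 \<le> s" "s \<le> x" "0 \<le> t" "t \<le> y" for s t
      using flat[of "(s, t)"] xy that by (simp add: cbox_Pair_eq)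
    have d: "((\<lambda>x. v (vector [x, t])) has_real_derivative pd 1 v (vector [s, t])) (at s)"
      "((\<lambda>y. v (vector [s, y])) has_real_derivative pd 2 v (vector [s, t])) (at t)" for s t
      by (intro has_pd_1_line has_pd_2_line has_pd_pd smooth_differentiable v)+
    have "((\<lambda>x. v (vector [x, y])) has_real_derivative 0) (at s within {0..x})" if "s \<in> {0..x}" for s
      using has_field_derivative_at_within[OF d(1)[where s = s and t = y], of "{0..x}"] in_cell[of s y] that xy
      by simp
    then have "\<exists>c. \<forall>s\<in>{0..x}. v (vector [s, y]) = c"
      by (intro has_field_derivative_zero_constant convex_real_interval)
    with xy have "v (vector [x, y]) = v (vector [0, y])"
      by (metis atLeastAtMost_iff order_refl)
    moreover have "((\<lambda>y. v (vector [0, y])) has_real_derivative 0) (at t within {0..y})" if "t \<in> {0..y}" for t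
      using has_field_derivative_at_within[OF d(2)[where s = 0 and t = t], of "{0..y}"] in_cell[of 0 t] that xy
      by simp
    then have "\<exists>c. \<forall>t\<in>{0..y}. v (vector [0, t]) = c"
      by (intro has_field_derivative_zero_constant convex_real_interval)
    with xy have "v (vector [0, y]) = v (vector [0, 0])"
      by (metis atLeastAtMost_iff order_refl)
    ultimately show ?thesis by (simp add: vector2_eq)
  qed
  have S: "(vector [x + 4 * pi / 3, y] :: real^2) = vector [x, y] + axis 1 (4 * pi / 3)"
    and T: "(vector [x, y + a3] :: real^2) = vector [x, y] + axis 2 a3" for x y
    by (simp_all add: vec_eq_iff forall_2 axis_def)
  \<comment> \<open>The reduction is applied to a function whose values are functions of y, so that
    one x serves every y and the second coordinate can be reduced afterwards.\<close>
  obtain x where x: "0 \<le> x" "x \<le> 4 * pi / 3" "(\<lambda>y. v (vector [p $ 1, y])) = (\<lambda>y. v (vector [x, y]))"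
    by (rule periodic_reduce[of "\<lambda>x y. v (vector [x, y])" "4 * pi / 3" "p $ 1"])
       (auto simp: S per)
  obtain y where y: "0 \<le> y" "y \<le> a3" "v (vector [x, p $ 2]) = v (vector [x, y])"
    by (rule periodic_reduce[of "\<lambda>y. v (vector [x, y])" a3 "p $ 2"])
       (auto simp: T per \<open>0 < a3\<close>)
  have "v p = v (vector [p $ 1, p $ 2])" using pt_surj[of p] by simp
  also have "\<dots> = v (vector [x, y])" using fun_cong[OF x(3), of "p $ 2"] y(3) by simp
  finally show ?thesis using cell x y by simp
qed

lemma graph_surface_eq_coordinate_torus:
  "graph_surface v = coordinate_torus c \<longleftrightarrow> (\<forall>p. v p = c)"
proof
  assume "graph_surface v = coordinate_torus c"
  then have "graph_map v p \<in> coordinate_torus c" for p by (auto simp: graph_surface_def)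
  then show "\<forall>p. v p = c" by (simp add: coordinate_torus_def)
next
  assume c: "\<forall>p. v p = c"
  have "x = graph_map v (vector [x $ 2, x $ 3])" if "x $ 1 = c" for x
    using that c by (simp add: graph_map_def vec_eq_iff forall_3)
  then show "graph_surface v = coordinate_torus c"
    using c by (auto simp: graph_surface_def coordinate_torus_def)
qed

theorem theorem1p1:
  fixes a3 m :: real and v :: "real^2 \<Rightarrow> real"
  assumes "0 < a3"
    and "m = geon_mass a3"
    and "graph_over_torus a3 v"
    and "\<forall>p. nonneg_definite (second_ff conf_metric v p)"
    and "(INF x\<in>graph_surface v. phi (x $ 1)) > 1"
  shows "Q_functional a3 v \<le> 3 * m / 2 \<and>
    (Q_functional a3 v = 3 * m / 2 \<longleftrightarrow> (\<exists>c. graph_surface v = coordinate_torus c))"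
proof -
  let ?C = "cbox (0, 0) (4 * pi / 3, a3)"
  have tf: "torus_function a3 v" and v0: "\<And>p. 0 \<le> v p"
    using assms(3) by (auto simp: graph_over_torus_def)
  then have v: "smooth v" by (simp add: torus_function_def)
  \<comment> \<open>Since phi >= 1 the infimum is a genuine lower bound, and phi = 1 at the core;
    thus the graph avoids s = 0, where the coordinates degenerate.\<close>
  have vpos: "0 < v p" for p
  proof -
    have "bdd_below ((\<lambda>x. phi (x $ 1)) ` graph_surface v)"
      using phi_ge_1 by (auto intro!: bdd_belowI)
    then have "(INF x\<in>graph_surface v. phi (x $ 1)) \<le> phi (graph_map v p $ 1)"
      by (rule cINF_lower) (auto simp: graph_surface_def)
    with assms(5) have "v p \<noteq> 0" by (auto simp: phi_0)
    with v0[of p] show ?thesis by simp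
  qed
  note bound = deficit_bound[OF v vpos assms(4)[rule_format]]
  define I where "I = integral ?C (\<lambda>z. deficit v (pt z))"
  have Q: "Q_functional a3 v = 3 * m / 2 - I"
    using Q_functional_eq[OF assms(1) tf vpos] by (simp add: I_def assms(2))
  have cont: "continuous_on ?C (\<lambda>z. deficit v (pt z))"
    by (rule continuous_on_compose2[OF continuous_flux_deficit(3)[OF v vpos] continuous_on_pt]) auto
  have I0: "0 \<le> I"
    unfolding I_def by (rule integral_nonneg) (auto intro: integrable_continuous cont bound(1))
  have "I = 0 \<longleftrightarrow> (\<exists>c. graph_surface v = coordinate_torus c)"
  proof
    assume I: "I = 0"
    have "pd 1 v (pt z) = 0 \<and> pd 2 v (pt z) = 0" if z: "z \<in> ?C" for z
    proof -
      \<comment> \<open>A continuous non-negative function with integral 0 over a cell with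
        non-empty interior vanishes on the whole closed cell.\<close>
      have "((\<lambda>z. deficit v (pt z)) has_integral 0) ?C"
        using integrable_integral[OF integrable_continuous[OF cont]] I by (simp add: I_def)
      moreover have "box (0, 0) (4 * pi / 3, a3) \<noteq> {}"
        using assms(1) by (auto simp: box_ne_empty Basis_prod_def)
      ultimately have "deficit v (pt z) = 0"
        using has_integral_0_cbox_imp_0[OF cont _ _ _ z] bound(1) by blast
      then show ?thesis using bound(2) by simp
    qed
    then have "v p = v 0" for p by (rule constant_if_flat_on_cell[OF tf assms(1)])
    then show "\<exists>c. graph_surface v = coordinate_torus c"
      using graph_surface_eq_coordinate_torus by blast
  next
    assume "\<exists>c. graph_surface v = coordinate_torus c"
    then obtain c where "\<And>p. v p = c" using graph_surface_eq_coordinate_torus by blast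
    then have "pd i v p = 0" for i p by (simp add: pd_def)
    then have "deficit v p = 0" for p using bound(2) by simp
    then show "I = 0" by (simp add: I_def)
  qed
  with Q I0 show ?thesis by auto
qed

end
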